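(* Let $f:\mathcal{C}_n\to\mathbb{R}$, let $p\in(0,1)$ and let $Y\sim\mu_p$. Then for every $t,\delta\in\mathbb{R}$ satisfying $0<\delta<\frac1n\phi_p(t-\delta)$, $$\log\mathbb{P}(f(Y)\ge tn)\le-\phi_p(t-\delta)\left(1-64Ln^{-1/3}\right),$$ where $$L=\frac1\delta\big(2\mathrm{Lip}(f)+|\log(p(1-p))|\big)^{2/3}\left(2\mathcal{D}(f)+\frac1\delta\mathrm{Lip}(f)^2\right)^{1/3}.$$ Moreover, whenever $\frac{1}{n\delta^2}\mathrm{Lip}(f)^2\le\frac12$, one also has $$\log\mathbb{P}(f(Y)\ge(t-\delta)n)\ge-\phi_p(t)\left(1+\frac{2}{n\delta^2}\mathrm{Lip}(f)^2\right)-2.$$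
   Context: $\mathcal{C}_n=\{-1,1\}^n$ with uniform probability measure $\mu$. For $0\le p\le1$, $\mu_p$ is the measure with $\frac{d\mu_p}{d\mu}(y)=\prod_{i\in[n]}(1-y_i(1-2p))$ (i.i.d. coordinates equal to $1$ with probability $p$). For $g:\mathcal{C}_n\to\mathbb{R}$, $\partial_i g(y)=\frac12\big(g(y_1,..,y_{i-1},1,y_{i+1},..,y_n)-g(y_1,..,y_{i-1},-1,y_{i+1},..,y_n)\big)$, $\nabla g=(\partial_1g,\dots,\partial_ng)$, $\mathrm{Lip}(g)=\max_{i,y}|\partial_ig(y)|$, $\mathbf{GW}(K)=\mathbb{E}\sup_{x\in K}\langle x,\Gamma\rangle$ with $\Gamma\sim N(0,\mathrm{Id}_n)$, $\mathcal{D}(g)=\mathbf{GW}(\{\nabla g(y):y\in\mathcal{C}_n\}\cup\{0\})$. The rate function is $\phi_p(t)=\inf\{\mathrm{D}_{\mathrm{KL}}(\xi\Vert\mu_p):\xi\in\mathcal{PM}(\mathcal{C}_n),\ \int f\,d\xi\ge tn\}$, where $\mathcal{PM}(\mathcal{C}_n)$ is the set of product probability measures on $\mathcal{C}_n$ and $\mathrm{D}_{\mathrm{KL}}(\nu_1\Vert\nu_2)=\int\log\frac{d\nu_1}{d\nu_2}d\nu_1$. *)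

theory Defs
  imports "HOL-Probability.Probability"
begin

definition cube :: "nat \<Rightarrow> (nat \<Rightarrow> real) set" where
  "cube n = PiE {..<n} (\<lambda>_. {-1, 1})"

text \<open>Point masses of mu_p: density w.r.t. the uniform measure is prod_i (1 - y_i(1-2p)).\<close>
definition mu_p :: "nat \<Rightarrow> real \<Rightarrow> (nat \<Rightarrow> real) \<Rightarrow> real" where
  "mu_p n p y = (1 / 2 ^ n) * (\<Prod>i<n. (1 - y i * (1 - 2 * p)))"

definition prob_p :: "nat \<Rightarrow> real \<Rightarrow> (nat \<Rightarrow> real) set \<Rightarrow> real" where
  "prob_p n p A = (\<Sum>y\<in>cube n \<inter> A. mu_p n p y)"

definition elog :: "real \<Rightarrow> ereal" where
  "elog x = (if x = 0 then -\<infinity> else ereal (ln x))"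

definition pd :: "nat \<Rightarrow> ((nat \<Rightarrow> real) \<Rightarrow> real) \<Rightarrow> (nat \<Rightarrow> real) \<Rightarrow> real" where
  "pd i g y = (g (y(i := 1)) - g (y(i := -1))) / 2"

definition grad :: "nat \<Rightarrow> ((nat \<Rightarrow> real) \<Rightarrow> real) \<Rightarrow> (nat \<Rightarrow> real) \<Rightarrow> (nat \<Rightarrow> real)" where
  "grad n g y = restrict (\<lambda>i. pd i g y) {..<n}"

definition Lip :: "nat \<Rightarrow> ((nat \<Rightarrow> real) \<Rightarrow> real) \<Rightarrow> real" where
  "Lip n g = Max (insert 0 {\<bar>pd i g y\<bar> | i y. i < n \<and> y \<in> cube n})"

definition gauss :: "nat \<Rightarrow> (nat \<Rightarrow> real) measure" where
  "gauss n = PiM {..<n} (\<lambda>_. density lborel std_normal_density)"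

definition GW :: "nat \<Rightarrow> (nat \<Rightarrow> real) set \<Rightarrow> real" where
  "GW n K = integral\<^sup>L (gauss n) (\<lambda>\<Gamma>. Sup ((\<lambda>x. \<Sum>i<n. x i * \<Gamma> i) ` K))"

definition DD :: "nat \<Rightarrow> ((nat \<Rightarrow> real) \<Rightarrow> real) \<Rightarrow> real" where
  "DD n g = GW n (grad n g ` cube n \<union> {\<lambda>_. 0})"

definition product_pm :: "nat \<Rightarrow> ((nat \<Rightarrow> real) \<Rightarrow> real) \<Rightarrow> bool" where
  "product_pm n \<xi> \<longleftrightarrow> (\<exists>q :: nat \<Rightarrow> real. (\<forall>i<n. 0 \<le> q i \<and> q i \<le> 1) \<and>
      (\<forall>y\<in>cube n. \<xi> y = (\<Prod>i<n. if y i = 1 then q i else 1 - q i)))"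

definition KL :: "nat \<Rightarrow> ((nat \<Rightarrow> real) \<Rightarrow> real) \<Rightarrow> ((nat \<Rightarrow> real) \<Rightarrow> real) \<Rightarrow> real" where
  "KL n \<nu>1 \<nu>2 = (\<Sum>y\<in>cube n. if \<nu>1 y = 0 then 0 else \<nu>1 y * ln (\<nu>1 y / \<nu>2 y))"

text \<open>Rate function; infimum of the empty set is +infinity.\<close>
definition phi :: "nat \<Rightarrow> real \<Rightarrow> ((nat \<Rightarrow> real) \<Rightarrow> real) \<Rightarrow> real \<Rightarrow> ereal" where
  "phi n p f t = Inf {ereal (KL n \<xi> (mu_p n p)) | \<xi>. product_pm n \<xi> \<and>
      (\<Sum>y\<in>cube n. f y * \<xi> y) \<ge> t * real n}"

end

theory Submission
  imports Defs
begin

text \<open>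
  Let \<open>\<nu>\<close> have density proportional to \<open>exp g\<close> with respect to \<open>\<mu>\<^sub>p\<close>, and tilt it by \<open>exp \<langle>W, y\<rangle>\<close> with
  \<open>W = r \<Gamma>\<close> and \<open>\<Gamma>\<close> Gaussian. On average the tilt changes the free energy by at most \<open>n r\<^sup>2\<close>. Integration
  by parts in \<open>\<Gamma>\<close> gives \<open>r E \<Sum>\<^sub>i Cov(\<partial>\<^sub>i g, y\<^sub>i) = E \<langle>\<Gamma>, mean of \<nabla>g\<rangle> \<le> D(g)\<close>, where covariance and mean are
  taken under the tilted measure. By a modified logarithmic Sobolev inequality that sum of covariances bounds the
  relative entropy of the tilted measure with respect to the product \<open>\<xi>\<close> of its marginals. The
  Gibbs variational principle and the bounded difference inequality for \<open>\<xi>\<close> turn this into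
  a bound on the difference of the means of \<open>g\<close>, so \<open>ln \<integral> exp g d\<mu>\<^sub>p\<close> is at most
  \<open>\<integral> g d\<xi> - KL(\<xi> | \<mu>\<^sub>p)\<close> up to a small error.

  For the upper tail, \<open>g\<close> is a concave quadratic-then-linear cutoff of \<open>f\<close>: it vanishes on \<open>f \<ge> t n\<close>, and concavity
  and Jensen's inequality bound the variational expression by \<open>- \<phi>\<^sub>p(t - \<delta>)\<close> for every product
  measure. For the lower tail, a product measure with \<open>\<integral> f d\<xi> \<ge> t n\<close> concentrates on \<open>f \<ge> (t - \<delta>) n\<close>, and
  the Gibbs variational principle for the indicator of this event compares the two probabilities.
\<close>

section \<open>Product measures on the cube\<close>

lemma finite_cube [simp]: "finite (cube n)"
  by (simp add: cube_def finite_PiE)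

text \<open>Splitting off the last coordinate is the recursion that drives the inductions on the
  dimension below.\<close>

lemma sum_cube_Suc:
  "(\<Sum>y\<in>cube (Suc n). F y) = (\<Sum>y\<in>cube n. F (y(n := 1)) + F (y(n := - 1)))"
proof -
  have eq: "cube (Suc n) = (\<lambda>(b, y). y(n := b)) ` ({-1, 1} \<times> cube n)"
    by (simp add: cube_def lessThan_Suc PiE_insert_eq)
  have "inj_on (\<lambda>(b, y). y(n := b)) ({-1, 1 :: real} \<times> cube n)"
    unfolding cube_def using inj_combinator[of n "{..<n}" "\<lambda>_. {- 1, 1}"] by simp
  then have "(\<Sum>y\<in>cube (Suc n). F y) = (\<Sum>(b, y)\<in>{-1, 1} \<times> cube n. F (y(n := b)))"
    by (simp add: eq sum.reindex case_prod_beta' comp_def)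
  also have "\<dots> = (\<Sum>b\<in>{-1, 1}. \<Sum>y\<in>cube n. F (y(n := b)))"
    by (simp add: sum.cartesian_product)
  finally show ?thesis by (simp add: sum.distrib add.commute)
qed

lemma cube_upd: "y \<in> cube n \<Longrightarrow> i < n \<Longrightarrow> b = 1 \<or> b = - 1 \<Longrightarrow> y(i := b) \<in> cube n"
  by (auto simp: cube_def PiE_iff extensional_def)

lemma cube_Suc_upd: "y \<in> cube n \<Longrightarrow> b = 1 \<or> b = - 1 \<Longrightarrow> y(n := b) \<in> cube (Suc n)"
  by (auto simp: cube_def PiE_iff extensional_def)

lemma cube_coord: "y \<in> cube n \<Longrightarrow> i < n \<Longrightarrow> y i = 1 \<or> y i = - 1"
  by (auto simp: cube_def PiE_iff)

lemma cube_nonempty [simp]: "cube n \<noteq> {}"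
  by (auto simp: cube_def PiE_eq_empty_iff)

lemma card_cube: "card (cube n) = 2 ^ n"
  by (simp add: cube_def card_PiE numeral_2_eq_2)

text \<open>Flipping coordinate \<open>i\<close> is an involution of the cube. On the right every
  point is counted twice, hence the division by 2. The dimension stays fixed, so any coordinate can
  be isolated.\<close>

lemma sum_cube_coord:
  assumes "i < n"
  shows "(\<Sum>y\<in>cube n. F y) = (\<Sum>y\<in>cube n. F (y(i := 1)) + F (y(i := - 1))) / (2::real)"
proof -
  have flip: "(\<Sum>y\<in>cube n. F y) = (\<Sum>y\<in>cube n. F (y(i := - y i)))"
    by (rule sum.reindex_bij_witness[where i = "\<lambda>y. y(i := - y i)" and j = "\<lambda>y. y(i := - y i)"])
       (use assms in \<open>auto intro!: cube_upd dest: cube_coord\<close>)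
  have "(\<Sum>y\<in>cube n. F (y(i := 1)) + F (y(i := - 1))) = (\<Sum>y\<in>cube n. F y + F (y(i := - y i)))"
  proof (rule sum.cong)
    fix y assume "y \<in> cube n"
    then consider "y i = 1" | "y i = - 1" using assms cube_coord by blast
    then show "F (y(i := 1)) + F (y(i := - 1)) = F y + F (y(i := - y i))"
    proof cases
      case 1
      then have "y(i := 1) = y" by auto
      with 1 show ?thesis by simp
    next
      case 2
      then have "y(i := - 1) = y" by auto
      with 2 show ?thesis by simp
    qed
  qed simp
  then show ?thesis using flip by (simp add: sum.distrib)
qed

text \<open>Bernoulli product weights, with \<open>q i\<close> the probability of the value 1. Any
  other value counts as -1, so positivity holds for every function, on or off the cube.\<close>

definition pw :: "nat \<Rightarrow> (nat \<Rightarrow> real) \<Rightarrow> (nat \<Rightarrow> real) \<Rightarrow> real" where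
  "pw n q y = (\<Prod>i<n. if y i = 1 then q i else 1 - q i)"

lemma pw_Suc_upd: "pw (Suc n) q (y(n := b)) = pw n q y * (if b = 1 then q n else 1 - q n)"
  by (simp add: pw_def)

lemma sum_pw: "(\<Sum>y\<in>cube n. pw n q y) = 1"
proof (induction n)
  case 0
  then show ?case by (simp add: cube_def pw_def)
next
  case (Suc n)
  have "(\<Sum>y\<in>cube (Suc n). pw (Suc n) q y) = (\<Sum>y\<in>cube n. pw n q y)"
    unfolding sum_cube_Suc by (rule sum.cong) (auto simp: pw_Suc_upd algebra_simps)
  with Suc show ?case by simp
qed

lemma pw_pos: "(\<And>i. i < n \<Longrightarrow> 0 < q i \<and> q i < 1) \<Longrightarrow> 0 < pw n q y"
  by (auto simp: pw_def intro!: prod_pos)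

lemma pw_nonneg: "(\<And>i. i < n \<Longrightarrow> 0 \<le> q i \<and> q i \<le> 1) \<Longrightarrow> 0 \<le> pw n q y"
  by (auto simp: pw_def intro!: prod_nonneg)

lemma pw_upd:
  assumes "i < n"
  shows "pw n q (y(i := 1)) = q i * (\<Prod>j\<in>{..<n} - {i}. if y j = 1 then q j else 1 - q j)"
    and "pw n q (y(i := - 1)) = (1 - q i) * (\<Prod>j\<in>{..<n} - {i}. if y j = 1 then q j else 1 - q j)"
  unfolding pw_def using assms by (subst prod.remove[of _ i]; auto intro!: prod.cong)+

lemma mu_p_eq_pw: "y \<in> cube n \<Longrightarrow> mu_p n p y = pw n (\<lambda>_. p) y"
proof -
  assume y: "y \<in> cube n"
  have "mu_p n p y = (\<Prod>i<n. (1/2) * (1 - y i * (1 - 2 * p)))"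
    unfolding mu_p_def prod.distrib by (simp add: power_one_over)
  also have "\<dots> = pw n (\<lambda>_. p) y"
    unfolding pw_def
  proof (rule prod.cong)
    fix i assume "i \<in> {..<n}"
    then show "(1/2) * (1 - y i * (1 - 2 * p)) = (if y i = 1 then p else 1 - p)"
      using cube_coord[OF y, of i] by auto
  qed simp
  finally show ?thesis .
qed

lemma sum_pw_coord:
  assumes "i < n"
  shows "(\<Sum>y\<in>cube n. pw n q y * y i) = 2 * q i - 1"
proof -
  let ?R = "\<lambda>y. \<Prod>j\<in>{..<n} - {i}. if y j = 1 then q j else 1 - q j"
  have "1 = (\<Sum>y\<in>cube n. pw n q y)" by (simp add: sum_pw)
  also have "\<dots> = (\<Sum>y\<in>cube n. ?R y) / 2"
    by (subst sum_cube_coord[OF assms]) (simp add: pw_upd[OF assms] algebra_simps)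
  \<comment> \<open>The product over the other coordinates is summed over both values of coordinate
    \<open>i\<close>, so its total is 2.\<close>
  finally have R: "(\<Sum>y\<in>cube n. ?R y) = 2" by simp
  have "(\<Sum>y\<in>cube n. pw n q y * y i) = (\<Sum>y\<in>cube n. (2 * q i - 1) * ?R y) / 2"
    by (subst sum_cube_coord[OF assms]) (simp add: pw_upd[OF assms] algebra_simps)
  also have "\<dots> = 2 * q i - 1" by (simp add: sum_distrib_left[symmetric] R)
  finally show ?thesis .
qed

text \<open>This is ln x <= x - 1 at x = \<open>\<xi> y * exp (G y) / (S * \<nu> y)\<close>,
  weighted by \<open>\<nu> y\<close> and summed; the right-hand sides add up to 1 - 1 = 0. Points
  with \<open>\<nu> y = 0\<close> follow the convention 0 ln 0 = 0.\<close>

lemma gibbs_variational: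
  fixes G \<nu> \<xi> :: "'a \<Rightarrow> real"
  assumes A: "finite A" and \<nu>: "\<And>y. y \<in> A \<Longrightarrow> 0 \<le> \<nu> y" and \<xi>: "\<And>y. y \<in> A \<Longrightarrow> 0 < \<xi> y"
    and \<nu>1: "sum \<nu> A = 1"
  shows "(\<Sum>y\<in>A. \<nu> y * G y) \<le> (\<Sum>y\<in>A. if \<nu> y = 0 then 0 else \<nu> y * ln (\<nu> y / \<xi> y))
           + ln (\<Sum>y\<in>A. \<xi> y * exp (G y))"
proof -
  define S where "S = (\<Sum>y\<in>A. \<xi> y * exp (G y))"
  have "A \<noteq> {}" using \<nu>1 by auto
  then have S: "0 < S" unfolding S_def using A \<xi> by (intro sum_pos) auto
  have "\<nu> y * G y - (if \<nu> y = 0 then 0 else \<nu> y * ln (\<nu> y / \<xi> y)) - \<nu> y * ln S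
      \<le> \<xi> y * exp (G y) / S - \<nu> y" if y: "y \<in> A" for y
  proof (cases "\<nu> y = 0")
    case True
    then show ?thesis using \<xi>[OF y] S by simp
  next
    case False
    then have v: "0 < \<nu> y" using \<nu>[OF y] by simp
    have "ln (\<xi> y * exp (G y) / (S * \<nu> y)) \<le> \<xi> y * exp (G y) / (S * \<nu> y) - 1"
      by (rule ln_le_minus_one) (use v S \<xi>[OF y] in auto)
    also have "ln (\<xi> y * exp (G y) / (S * \<nu> y)) = G y - ln (\<nu> y / \<xi> y) - ln S"
      using v S \<xi>[OF y] by (simp add: ln_div ln_mult)
    finally have "\<nu> y * (G y - ln (\<nu> y / \<xi> y) - ln S) \<le> \<nu> y * (\<xi> y * exp (G y) / (S * \<nu> y) - 1)"
      using v by (intro mult_left_mono) auto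
    also have "\<dots> = \<xi> y * exp (G y) / S - \<nu> y" using v S by (simp add: field_simps)
    finally show ?thesis using False by (simp add: algebra_simps)
  qed
  then have "(\<Sum>y\<in>A. \<nu> y * G y - (if \<nu> y = 0 then 0 else \<nu> y * ln (\<nu> y / \<xi> y)) - \<nu> y * ln S)
      \<le> (\<Sum>y\<in>A. \<xi> y * exp (G y) / S - \<nu> y)"
    by (rule sum_mono)
  also have "\<dots> = 0"
    using S by (simp add: sum_subtractf \<nu>1 sum_divide_distrib[symmetric] S_def[symmetric])
  finally show ?thesis
    by (simp add: sum_subtractf sum_distrib_right[symmetric] \<nu>1 S_def)
qed

text \<open>Hoeffding's lemma for two values: as the gap \<open>h\<close> is at most 2c, the
  exponent h^2 / 8 is at most c^2 / 2. The order of \<open>a\<close> and \<open>b\<close> is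
  reversed by replacing \<open>q\<close> with \<open>1 - q\<close>.\<close>

lemma hoeffding_two_point:
  fixes a b q c :: real
  assumes q: "0 \<le> q" "q \<le> 1" and "\<bar>a - b\<bar> \<le> 2 * c"
  shows "q * exp a + (1 - q) * exp b \<le> exp (q * a + (1 - q) * b + c\<^sup>2 / 2)"
proof -
  have main: "q * exp a + (1 - q) * exp b \<le> exp (q * a + (1 - q) * b + c\<^sup>2 / 2)"
    if "0 \<le> q" "q \<le> 1" "b \<le> a" "a - b \<le> 2 * c" for a b q :: real
  proof -
    define h where "h = a - b"
    have "- h * q + ln (1 + q * (exp h - 1)) \<le> h\<^sup>2 / 8"
      by (rule Hoeffdings_lemma_aux) (use that in \<open>auto simp: h_def\<close>)
    moreover have "h\<^sup>2 \<le> (2 * c)\<^sup>2" using that by (intro power_mono) (auto simp: h_def)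
    ultimately have "ln (1 + q * (exp h - 1)) \<le> h * q + c\<^sup>2 / 2" by (simp add: power_mult_distrib)
    moreover have "0 < 1 + q * (exp h - 1)"
    proof -
      have "1 \<le> exp h" using that by (simp add: h_def)
      then have "0 \<le> q * (exp h - 1)" using that by simp
      then show ?thesis by simp
    qed
    ultimately have "1 + q * (exp h - 1) \<le> exp (h * q + c\<^sup>2 / 2)"
      by (metis exp_le_cancel_iff exp_ln)
    then have "exp b * (1 + q * (exp h - 1)) \<le> exp b * exp (h * q + c\<^sup>2 / 2)"
      by (intro mult_left_mono) auto
    moreover have "exp b * (1 + q * (exp h - 1)) = q * exp a + (1 - q) * exp b"
      by (simp add: h_def exp_diff field_simps)
    moreover have "exp b * exp (h * q + c\<^sup>2 / 2) = exp (q * a + (1 - q) * b + c\<^sup>2 / 2)"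
      by (simp add: h_def exp_add[symmetric] algebra_simps)
    ultimately show ?thesis by simp
  qed
  show ?thesis
  proof (cases "b \<le> a")
    case True
    then show ?thesis using main[of q b a] assms by simp
  next
    case False
    then show ?thesis using main[of "1 - q" a b] assms by (simp add: add.commute)
  qed
qed

text \<open>McDiarmid's argument as an induction: averaging over the last coordinate, which gives
  \<open>g'\<close>, preserves the bounded differences, and Hoeffding's lemma costs c^2 / 2 per
  coordinate.\<close>

lemma bounded_differences_mgf:
  assumes "\<And>i. i < n \<Longrightarrow> 0 \<le> q i \<and> q i \<le> 1"
    and "\<And>y i. y \<in> cube n \<Longrightarrow> i < n \<Longrightarrow> \<bar>g (y(i := 1)) - g (y(i := - 1))\<bar> \<le> 2 * c"
  shows "(\<Sum>y\<in>cube n. pw n q y * exp (g y)) \<le> exp ((\<Sum>y\<in>cube n. pw n q y * g y) + real n * c\<^sup>2 / 2)"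
  using assms
proof (induction n arbitrary: g)
  case 0
  then show ?case by (simp add: cube_def pw_def)
next
  case (Suc n)
  define g' where "g' y = q n * g (y(n := 1)) + (1 - q n) * g (y(n := - 1))" for y
  have q: "0 \<le> q n" "q n \<le> 1" using Suc.prems(1)[of n] by auto
  have diff: "\<bar>g' (y(i := 1)) - g' (y(i := - 1))\<bar> \<le> 2 * c" if "y \<in> cube n" "i < n" for y i
  proof -
    have *: "\<bar>g (y(i := 1, n := b)) - g (y(i := - 1, n := b))\<bar> \<le> 2 * c" if "b = 1 \<or> b = - 1" for b
      using Suc.prems(2)[OF cube_Suc_upd[OF \<open>y \<in> cube n\<close> that], of i] \<open>i < n\<close>
      by (simp only: fun_upd_twist[of n i] less_SucI simp_thms)
    have "g' (y(i := 1)) - g' (y(i := - 1)) = q n * (g (y(i := 1, n := 1)) - g (y(i := - 1, n := 1)))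
        + (1 - q n) * (g (y(i := 1, n := - 1)) - g (y(i := - 1, n := - 1)))"
      by (simp add: g'_def algebra_simps)
    also have "\<bar>\<dots>\<bar> \<le> q n * (2 * c) + (1 - q n) * (2 * c)"
      by (rule order_trans[OF abs_triangle_ineq])
         (use q * in \<open>auto simp: abs_mult intro!: add_mono mult_left_mono\<close>)
    finally show ?thesis by (simp add: algebra_simps)
  qed
  have "(\<Sum>y\<in>cube (Suc n). pw (Suc n) q y * exp (g y))
      = (\<Sum>y\<in>cube n. pw n q y * (q n * exp (g (y(n := 1))) + (1 - q n) * exp (g (y(n := - 1)))))"
    by (simp add: sum_cube_Suc pw_Suc_upd algebra_simps)
  also have "\<dots> \<le> (\<Sum>y\<in>cube n. pw n q y * exp (g' y + c\<^sup>2 / 2))"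
  proof (intro sum_mono mult_left_mono)
    fix y assume y: "y \<in> cube n"
    show "q n * exp (g (y(n := 1))) + (1 - q n) * exp (g (y(n := - 1))) \<le> exp (g' y + c\<^sup>2 / 2)"
      unfolding g'_def
      using Suc.prems(2)[OF cube_Suc_upd[OF y, of 1], of n]
      by (intro hoeffding_two_point q) (simp only: fun_upd_upd lessI simp_thms)
    show "0 \<le> pw n q y" using Suc.prems(1) by (intro pw_nonneg) auto
  qed
  also have "\<dots> = (\<Sum>y\<in>cube n. pw n q y * exp (g' y)) * exp (c\<^sup>2 / 2)"
    by (simp add: exp_add sum_distrib_right mult.assoc)
  also have "\<dots> \<le> exp ((\<Sum>y\<in>cube n. pw n q y * g' y) + real n * c\<^sup>2 / 2) * exp (c\<^sup>2 / 2)"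
    by (intro mult_right_mono Suc.IH diff) (use Suc.prems(1) in auto)
  also have "\<dots> = exp ((\<Sum>y\<in>cube n. pw n q y * g' y) + real (Suc n) * c\<^sup>2 / 2)"
    by (simp add: exp_add[symmetric] algebra_simps add_divide_distrib)
  also have "(\<Sum>y\<in>cube n. pw n q y * g' y) = (\<Sum>y\<in>cube (Suc n). pw (Suc n) q y * g y)"
    by (simp add: sum_cube_Suc pw_Suc_upd g'_def algebra_simps)
  finally show ?case .
qed

section \<open>Entropy inequalities\<close>

text \<open>Again ln x <= x - 1, now at the ratio of \<open>b y / a y\<close> to
  \<open>?b / ?a\<close>; the linear terms cancel in the sum.\<close>

lemma log_sum:
  fixes a b :: "'a \<Rightarrow> real"
  assumes "finite A" "A \<noteq> {}" and a: "\<And>y. y \<in> A \<Longrightarrow> 0 < a y" and b: "\<And>y. y \<in> A \<Longrightarrow> 0 < b y"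
  shows "sum a A * ln (sum a A / sum b A) \<le> (\<Sum>y\<in>A. a y * ln (a y / b y))"
proof -
  let ?a = "sum a A" and ?b = "sum b A"
  have ab: "0 < ?a" "0 < ?b" using assms by (auto intro!: sum_pos)
  have "a y - b y * (?a / ?b) \<le> a y * ln (a y / b y) - a y * ln (?a / ?b)" if y: "y \<in> A" for y
  proof -
    note p = a[OF y] b[OF y] ab
    have "ln (b y * ?a / (a y * ?b)) \<le> b y * ?a / (a y * ?b) - 1"
      by (rule ln_le_minus_one) (use p in auto)
    moreover have "ln (b y * ?a / (a y * ?b)) = ln (?a / ?b) - ln (a y / b y)"
      using p by (simp add: ln_div ln_mult)
    ultimately have "a y * (1 - b y * ?a / (a y * ?b)) \<le> a y * (ln (a y / b y) - ln (?a / ?b))"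
      using p by (intro mult_left_mono) auto
    moreover have "a y * (1 - b y * ?a / (a y * ?b)) = a y - b y * (?a / ?b)"
      using p by (simp add: field_simps)
    ultimately show ?thesis by (simp add: algebra_simps)
  qed
  then have "(\<Sum>y\<in>A. a y - b y * (?a / ?b)) \<le> (\<Sum>y\<in>A. a y * ln (a y / b y) - a y * ln (?a / ?b))"
    by (rule sum_mono)
  then show ?thesis
    using ab by (simp add: sum_subtractf sum_distrib_right[symmetric] sum_divide_distrib[symmetric])
qed

text \<open>Joint convexity of \<open>(a - b) (ln a - ln b)\<close>, which drives the tensorisation in the next lemmas.\<close>

lemma sum_diff_ln_diff:
  fixes a b w :: "'a \<Rightarrow> real"
  assumes "finite A" "A \<noteq> {}" and w: "\<And>y. y \<in> A \<Longrightarrow> 0 < w y"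
    and a: "\<And>y. y \<in> A \<Longrightarrow> 0 < a y" and b: "\<And>y. y \<in> A \<Longrightarrow> 0 < b y"
  defines "\<alpha> \<equiv> \<Sum>y\<in>A. w y * a y" and "\<beta> \<equiv> \<Sum>y\<in>A. w y * b y"
  shows "(\<alpha> - \<beta>) * (ln \<alpha> - ln \<beta>) \<le> (\<Sum>y\<in>A. w y * ((a y - b y) * (ln (a y) - ln (b y))))"
proof -
  have p: "0 < \<alpha>" "0 < \<beta>" using assms by (auto intro!: sum_pos)
  have 1: "\<alpha> * ln (\<alpha> / \<beta>) \<le> (\<Sum>y\<in>A. w y * a y * ln (w y * a y / (w y * b y)))"
    unfolding \<alpha>_def \<beta>_def by (rule log_sum) (use assms in auto)
  have 2: "\<beta> * ln (\<beta> / \<alpha>) \<le> (\<Sum>y\<in>A. w y * b y * ln (w y * b y / (w y * a y)))"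
    unfolding \<alpha>_def \<beta>_def by (rule log_sum) (use assms in auto)
  have "(\<alpha> - \<beta>) * (ln \<alpha> - ln \<beta>) = \<alpha> * ln (\<alpha> / \<beta>) + \<beta> * ln (\<beta> / \<alpha>)"
    using p by (simp add: ln_div algebra_simps)
  also have "\<dots> \<le> (\<Sum>y\<in>A. w y * a y * ln (w y * a y / (w y * b y)) + w y * b y * ln (w y * b y / (w y * a y)))"
    using 1 2 by (simp add: sum.distrib)
  also have "\<dots> = (\<Sum>y\<in>A. w y * ((a y - b y) * (ln (a y) - ln (b y))))"
  proof (rule sum.cong)
    fix y assume y: "y \<in> A"
    then show "w y * a y * ln (w y * a y / (w y * b y)) + w y * b y * ln (w y * b y / (w y * a y))
        = w y * ((a y - b y) * (ln (a y) - ln (b y)))"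
      using w[OF y] a[OF y] b[OF y] by (simp add: ln_div algebra_simps)
  qed simp
  finally show ?thesis .
qed

text \<open>With m the mean, the right side minus the left side equals m (ln m - q ln a - (1 - q) ln
  b), which is nonnegative by concavity of the logarithm.\<close>

lemma two_point_entropy:
  fixes q a b :: real
  assumes q: "0 < q" "q < 1" and ab: "0 < a" "0 < b"
  shows "q * (a * ln a) + (1 - q) * (b * ln b) - (q * a + (1 - q) * b) * ln (q * a + (1 - q) * b)
           \<le> q * (1 - q) * ((a - b) * (ln a - ln b))"
proof -
  let ?m = "q * a + (1 - q) * b"
  have m: "0 < ?m" using assms by (simp add: add_pos_pos)
  have "ln (a / ?m) \<le> a / ?m - 1" "ln (b / ?m) \<le> b / ?m - 1"
    by (rule ln_le_minus_one; use assms m in simp)+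
  then have "q * (ln a - ln ?m) + (1 - q) * (ln b - ln ?m) \<le> q * (a / ?m - 1) + (1 - q) * (b / ?m - 1)"
    using assms m by (intro add_mono mult_left_mono) (auto simp: ln_div)
  also have "\<dots> = 0" using m by (simp add: field_simps)
  finally have "q * ln a + (1 - q) * ln b \<le> ln ?m" by (simp add: algebra_simps)
  then have "?m * (q * ln a + (1 - q) * ln b) \<le> ?m * ln ?m" using m by (intro mult_left_mono) auto
  then show ?thesis by (simp add: algebra_simps)
qed

text \<open>Chain rule for entropy along the last coordinate. The entropies on the two slices are
  bounded by induction. The entropy of the pair of slice means is bounded by
  \<open>two_point_entropy\<close>, and joint convexity moves the resulting Dirichlet term inside
  the average over the slice.\<close>

lemma modified_log_sobolev:
  fixes h :: "(nat \<Rightarrow> real) \<Rightarrow> real"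
  assumes "\<And>i. i < n \<Longrightarrow> 0 < q i \<and> q i < 1" and "\<And>y. 0 < h y"
  shows "(\<Sum>y\<in>cube n. pw n q y * (h y * ln (h y)))
           - (\<Sum>y\<in>cube n. pw n q y * h y) * ln (\<Sum>y\<in>cube n. pw n q y * h y)
         \<le> (\<Sum>i<n. \<Sum>y\<in>cube n. pw n q y * (q i * (1 - q i) *
              ((h (y(i := 1)) - h (y(i := - 1))) * (ln (h (y(i := 1))) - ln (h (y(i := - 1)))))))"
  using assms
proof (induction n arbitrary: h)
  case 0
  then show ?case by (simp add: cube_def pw_def)
next
  case (Suc n)
  have q: "0 < q n" "q n < 1" using Suc.prems(1)[of n] by auto
  have h: "0 < h y" for y by (rule Suc.prems)
  let ?s = "\<lambda>F. \<Sum>y\<in>cube n. pw n q y * F y"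
  let ?D = "\<lambda>u v :: real. (u - v) * (ln u - ln v)"
  define hp where "hp y = h (y(n := 1))" for y
  define hm where "hm y = h (y(n := - 1))" for y
  define Dp where "Dp = (\<Sum>i<n. ?s (\<lambda>y. q i * (1 - q i) * ?D (hp (y(i := 1))) (hp (y(i := - 1)))))"
  define Dm where "Dm = (\<Sum>i<n. ?s (\<lambda>y. q i * (1 - q i) * ?D (hm (y(i := 1))) (hm (y(i := - 1)))))"
  have w: "0 < pw n q y" for y using Suc.prems(1) by (intro pw_pos) auto
  have p: "0 < ?s hp" "0 < ?s hm"
    by (auto intro!: sum_pos mult_pos_pos w simp: hp_def hm_def h)
  have "?s (\<lambda>y. hp y * ln (hp y)) - ?s hp * ln (?s hp) \<le> Dp"
    unfolding Dp_def by (rule Suc.IH) (use Suc.prems(1) h in \<open>auto simp: hp_def\<close>)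
  then have Ip: "q n * ?s (\<lambda>y. hp y * ln (hp y)) - q n * (?s hp * ln (?s hp)) \<le> q n * Dp"
    using mult_left_mono[of _ Dp "q n"] q by (simp only: right_diff_distrib[symmetric])
  have "?s (\<lambda>y. hm y * ln (hm y)) - ?s hm * ln (?s hm) \<le> Dm"
    unfolding Dm_def by (rule Suc.IH) (use Suc.prems(1) h in \<open>auto simp: hm_def\<close>)
  then have Im: "(1 - q n) * ?s (\<lambda>y. hm y * ln (hm y)) - (1 - q n) * (?s hm * ln (?s hm)) \<le> (1 - q n) * Dm"
    using mult_left_mono[of _ Dm "1 - q n"] q by (simp only: right_diff_distrib[symmetric])
  have "q n * (?s hp * ln (?s hp)) + (1 - q n) * (?s hm * ln (?s hm))
        - (q n * ?s hp + (1 - q n) * ?s hm) * ln (q n * ?s hp + (1 - q n) * ?s hm)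
      \<le> q n * (1 - q n) * ?D (?s hp) (?s hm)"
    by (rule two_point_entropy) (use q p in auto)
  also have "\<dots> \<le> q n * (1 - q n) * ?s (\<lambda>y. ?D (hp y) (hm y))"
    by (intro mult_left_mono sum_diff_ln_diff) (use q w h in \<open>auto simp: hp_def hm_def\<close>)
  finally have In: "q n * (?s hp * ln (?s hp)) + (1 - q n) * (?s hm * ln (?s hm))
        - (q n * ?s hp + (1 - q n) * ?s hm) * ln (q n * ?s hp + (1 - q n) * ?s hm)
      \<le> q n * (1 - q n) * ?s (\<lambda>y. ?D (hp y) (hm y))" .
  have split: "(\<Sum>y\<in>cube (Suc n). pw (Suc n) q y * F y)
      = q n * ?s (\<lambda>y. F (y(n := 1))) + (1 - q n) * ?s (\<lambda>y. F (y(n := - 1)))" for F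
    unfolding sum_cube_Suc sum_distrib_left sum.distrib[symmetric]
    by (rule sum.cong) (simp_all add: pw_Suc_upd algebra_simps)
  have twist: "y(n := b, i := c) = y(i := c, n := b)" if "i < n" for y :: "nat \<Rightarrow> real" and b c i
    using that by (simp add: fun_upd_twist)
  have Ei: "(\<Sum>i<n. \<Sum>y\<in>cube (Suc n). pw (Suc n) q y * (q i * (1 - q i) * ?D (h (y(i := 1))) (h (y(i := - 1)))))
      = q n * Dp + (1 - q n) * Dm"
    unfolding split Dp_def Dm_def sum_distrib_left[of "q n"] sum_distrib_left[of "1 - q n"] sum.distrib
    by (intro arg_cong2[where f = "(+)"] sum.cong refl)
       (auto simp: hp_def hm_def twist)
  have pull: "?s (\<lambda>y. c * F y) = c * ?s F" for c F
    by (simp add: sum_distrib_left algebra_simps)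
  define S where "S = ?s (\<lambda>y. ?D (hp y) (hm y))"
  have En: "(\<Sum>y\<in>cube (Suc n). pw (Suc n) q y * (q n * (1 - q n) * ?D (h (y(n := 1))) (h (y(n := - 1)))))
      = q n * (1 - q n) * S"
    unfolding split fun_upd_upd
    unfolding hp_def[symmetric] hm_def[symmetric] pull
    unfolding S_def[symmetric] by (simp add: algebra_simps)
  show ?case
    unfolding sum.lessThan_Suc Ei En unfolding split
    using Ip Im In by (simp add: hp_def[symmetric] hm_def[symmetric] S_def[symmetric])
qed

section \<open>Covariances and the product of the marginals\<close>

definition cov :: "nat \<Rightarrow> ((nat \<Rightarrow> real) \<Rightarrow> real) \<Rightarrow> ((nat \<Rightarrow> real) \<Rightarrow> real) \<Rightarrow> ((nat \<Rightarrow> real) \<Rightarrow> real) \<Rightarrow> real" where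
  "cov n \<nu> a b = (\<Sum>y\<in>cube n. \<nu> y * (a y * b y)) - (\<Sum>y\<in>cube n. \<nu> y * a y) * (\<Sum>y\<in>cube n. \<nu> y * b y)"

lemma cov_add_const:
  assumes "\<And>y. y \<in> cube n \<Longrightarrow> a y = a' y + c" and "sum \<nu> (cube n) = 1"
  shows "cov n \<nu> a b = cov n \<nu> a' b"
proof -
  have "(\<Sum>y\<in>cube n. \<nu> y * (a y * b y)) = (\<Sum>y\<in>cube n. \<nu> y * (a' y * b y)) + c * (\<Sum>y\<in>cube n. \<nu> y * b y)"
    unfolding sum_distrib_left sum.distrib[symmetric] using assms(1)
    by (intro sum.cong) (auto simp: algebra_simps)
  moreover have "(\<Sum>y\<in>cube n. \<nu> y * a y) = (\<Sum>y\<in>cube n. \<nu> y * a' y) + c * sum \<nu> (cube n)"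
    unfolding sum_distrib_left sum.distrib[symmetric] using assms(1)
    by (intro sum.cong) (auto simp: algebra_simps)
  ultimately show ?thesis using assms(2) by (simp add: cov_def algebra_simps)
qed

text \<open>\<open>q\<close> is the mass of the half cube where coordinate \<open>i\<close> is 1,
  and both halves have positive mass. \<open>P\<close> and \<open>M\<close> count each half twice,
  hence \<open>P + M = 2\<close>.\<close>

lemma marginal_bounds:
  assumes "i < n" and \<nu>: "\<And>y. 0 < \<nu> y" and \<nu>1: "sum \<nu> (cube n) = 1"
  defines "q \<equiv> (1 + (\<Sum>y\<in>cube n. \<nu> y * y i)) / 2"
  shows "0 < q \<and> q < 1"
proof -
  define P where "P = (\<Sum>y\<in>cube n. \<nu> (y(i := 1)))"
  define M where "M = (\<Sum>y\<in>cube n. \<nu> (y(i := - 1)))"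
  have "0 < P" "0 < M" unfolding P_def M_def using \<nu> by (auto intro!: sum_pos)
  moreover have "P + M = 2"
    using \<nu>1 sum_cube_coord[OF \<open>i < n\<close>, of \<nu>] by (simp add: P_def M_def sum.distrib)
  moreover have "(\<Sum>y\<in>cube n. \<nu> y * y i) = (P - M) / 2"
    by (subst sum_cube_coord[OF \<open>i < n\<close>]) (simp add: P_def M_def sum_subtractf)
  ultimately show ?thesis by (simp add: q_def)
qed

text \<open>The relative entropy with respect to the product of the marginals is thus controlled by covariances
  that Gaussian integration by parts can evaluate.\<close>

lemma dirichlet_eq_cov:
  assumes i: "i < n" and \<nu>: "\<And>y. 0 < \<nu> y" and \<nu>1: "sum \<nu> (cube n) = 1"
    and q: "\<And>i. i < n \<Longrightarrow> 0 < q i \<and> q i < 1"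
    and qi: "q i = (1 + (\<Sum>y\<in>cube n. \<nu> y * y i)) / 2"
  defines "h \<equiv> \<lambda>y. \<nu> y / pw n q y"
  shows "(\<Sum>y\<in>cube n. pw n q y * (q i * (1 - q i) *
              ((h (y(i := 1)) - h (y(i := - 1))) * (ln (h (y(i := 1))) - ln (h (y(i := - 1)))))))
          = cov n \<nu> (pd i (\<lambda>y. ln (\<nu> y))) (\<lambda>y. y i)"
proof -
  define R where "R y = (\<Prod>j\<in>{..<n} - {i}. if y j = 1 then q j else 1 - q j)" for y :: "nat \<Rightarrow> real"
  \<comment> \<open>Half the log odds of \<open>q i\<close>, which is the discrete derivative of
    \<open>ln (pw n q y)\<close> in direction \<open>i\<close>.\<close>
  define \<theta> where "\<theta> = (ln (q i) - ln (1 - q i)) / 2"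
  define m where "m = (\<Sum>y\<in>cube n. \<nu> y * y i)"
  define d where "d = pd i (\<lambda>y. ln (\<nu> y))"
  have qi': "0 < q i" "q i < 1" using q[OF i] by auto
  have m: "m = 2 * q i - 1" using qi by (simp add: m_def)
  have R: "0 < R y" for y unfolding R_def using q by (intro prod_pos) auto
  have R_upd: "R (y(i := b)) = R y" for y b unfolding R_def by (intro prod.cong) auto
  have pwp: "pw n q (y(i := 1)) = q i * R y" and pwm: "pw n q (y(i := - 1)) = (1 - q i) * R y" for y
    using pw_upd[OF i, of q y] by (auto simp: R_def)
  have hp: "\<nu> (y(i := 1)) = h (y(i := 1)) * (q i * R y)"
    and hm: "\<nu> (y(i := - 1)) = h (y(i := - 1)) * ((1 - q i) * R y)" for y
    using qi' R[of y] by (auto simp: h_def pwp pwm)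
  have lh: "ln (h (y(i := 1))) - ln (h (y(i := - 1))) = 2 * (d y - \<theta>)" for y
  proof -
    have pos: "0 < \<nu> (y(i := 1))" "0 < \<nu> (y(i := - 1))" "0 < 1 - q i" using \<nu> qi' by auto
    have "ln (h (y(i := 1))) = ln (\<nu> (y(i := 1))) - (ln (q i) + ln (R y))"
      unfolding h_def pwp using pos qi' R[of y] by (subst ln_div, auto simp: ln_mult)
    moreover have "ln (h (y(i := - 1))) = ln (\<nu> (y(i := - 1))) - (ln (1 - q i) + ln (R y))"
      unfolding h_def pwm using pos qi' R[of y] by (subst ln_div, auto simp: ln_mult simp del: diff_gt_0_iff_gt)
    ultimately show ?thesis by (simp add: d_def pd_def \<theta>_def field_simps)
  qed
  have d_upd: "d (y(i := b)) = d y" for y b by (simp add: d_def pd_def)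
  have "(\<Sum>y\<in>cube n. pw n q y * (q i * (1 - q i) *
              ((h (y(i := 1)) - h (y(i := - 1))) * (ln (h (y(i := 1))) - ln (h (y(i := - 1)))))))
      = (\<Sum>y\<in>cube n. R y * (q i * (1 - q i) * ((h (y(i := 1)) - h (y(i := - 1))) * (2 * (d y - \<theta>))))) / 2"
    unfolding lh by (subst sum_cube_coord[OF i]) (simp add: pwp pwm d_upd algebra_simps)
  \<comment> \<open>The factors 1 - m = 2 (1 - q i) and -1 - m = -2 q i are the values of
    \<open>y i - m\<close> at the two endpoints; together with \<open>R y\<close> they turn
    \<open>h\<close> back into \<open>\<nu>\<close>.\<close>
  also have "\<dots> = (\<Sum>y\<in>cube n. \<nu> (y(i := 1)) * ((d y - \<theta>) * (1 - m)) + \<nu> (y(i := - 1)) * ((d y - \<theta>) * (- 1 - m))) / 2"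
    unfolding hp hm m by (intro arg_cong[where f = "\<lambda>x. x / 2"] sum.cong) (auto simp: algebra_simps)
  also have "\<dots> = (\<Sum>y\<in>cube n. \<nu> y * ((d y - \<theta>) * (y i - m)))"
    by (subst (2) sum_cube_coord[OF i]) (simp add: d_upd)
  \<comment> \<open>As \<open>m\<close> is the mean of \<open>y i\<close>, the two
    \<open>\<theta>\<close> terms cancel and only the covariance survives.\<close>
  also have "\<dots> = (\<Sum>y\<in>cube n. \<nu> y * (d y * y i)) - m * (\<Sum>y\<in>cube n. \<nu> y * d y)
        - \<theta> * (\<Sum>y\<in>cube n. \<nu> y * y i) + \<theta> * m * sum \<nu> (cube n)"
    unfolding sum_distrib_left sum_subtractf[symmetric] sum.distrib[symmetric]
    by (intro sum.cong) (auto simp: algebra_simps)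
  also have "\<dots> = cov n \<nu> d (\<lambda>y. y i)"
    by (simp add: cov_def \<nu>1 m_def)
  finally show ?thesis by (simp add: d_def)
qed

text \<open>With \<open>h\<close> the density of \<open>\<nu>\<close> relative to the product of its
  marginals, the relative entropy is the entropy functional of \<open>h\<close>, since the
  subtracted term is 1 ln 1 = 0.\<close>

lemma KL_product_marginals_le:
  assumes \<nu>: "\<And>y. 0 < \<nu> y" and \<nu>1: "sum \<nu> (cube n) = 1"
  defines "q \<equiv> \<lambda>i. (1 + (\<Sum>y\<in>cube n. \<nu> y * y i)) / 2"
  shows "KL n \<nu> (pw n q) \<le> (\<Sum>i<n. cov n \<nu> (pd i (\<lambda>y. ln (\<nu> y))) (\<lambda>y. y i))"
proof -
  have q: "0 < q i \<and> q i < 1" if "i < n" for i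
    unfolding q_def using marginal_bounds[OF that \<nu> \<nu>1] .
  have w: "0 < pw n q y" for y using q by (rule pw_pos)
  define h where "h y = \<nu> y / pw n q y" for y
  have eq: "pw n q y * h y = \<nu> y" for y using w[of y] by (simp add: h_def)
  have "KL n \<nu> (pw n q) = (\<Sum>y\<in>cube n. pw n q y * (h y * ln (h y)))"
    unfolding KL_def using \<nu> by (intro sum.cong) (auto simp: mult.assoc[symmetric] eq h_def less_imp_neq)
  also have "\<dots> = (\<Sum>y\<in>cube n. pw n q y * (h y * ln (h y)))
           - (\<Sum>y\<in>cube n. pw n q y * h y) * ln (\<Sum>y\<in>cube n. pw n q y * h y)"
    by (simp add: eq \<nu>1)
  also have "\<dots> \<le> (\<Sum>i<n. \<Sum>y\<in>cube n. pw n q y * (q i * (1 - q i) *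
              ((h (y(i := 1)) - h (y(i := - 1))) * (ln (h (y(i := 1))) - ln (h (y(i := - 1)))))))"
    by (rule modified_log_sobolev) (use q w \<nu> in \<open>auto simp: h_def\<close>)
  also have "\<dots> = (\<Sum>i<n. cov n \<nu> (pd i (\<lambda>y. ln (\<nu> y))) (\<lambda>y. y i))"
    unfolding h_def by (intro sum.cong dirichlet_eq_cov refl) (use q \<nu> \<nu>1 in \<open>auto simp: q_def\<close>)
  finally show ?thesis .
qed

text \<open>The logarithm of a product weight is affine in the coordinates, so its mean under a
  probability measure depends only on the marginal means.\<close>

lemma ln_pw:
  assumes y: "y \<in> cube n" and q: "\<And>i. i < n \<Longrightarrow> 0 < q i \<and> q i < 1"
  shows "ln (pw n q y) = (\<Sum>i<n. (ln (q i) + ln (1 - q i)) / 2 + (ln (q i) - ln (1 - q i)) / 2 * y i)"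
proof -
  have "ln (pw n q y) = (\<Sum>i<n. ln (if y i = 1 then q i else 1 - q i))"
    unfolding pw_def 
  proof (rule ln_prod)
    show "(if y i = 1 then q i else 1 - q i) \<noteq> 0" if "i \<in> {..<n}" for i
      using q[of i] that by auto
  qed simp
  also have "\<dots> = (\<Sum>i<n. (ln (q i) + ln (1 - q i)) / 2 + (ln (q i) - ln (1 - q i)) / 2 * y i)"
  proof (rule sum.cong)
    fix i assume "i \<in> {..<n}"
    then show "ln (if y i = 1 then q i else 1 - q i)
        = (ln (q i) + ln (1 - q i)) / 2 + (ln (q i) - ln (1 - q i)) / 2 * y i"
      using cube_coord[OF y, of i] by (auto simp: field_simps)
  qed simp
  finally show ?thesis .
qed

lemma sum_ln_pw:
  assumes q: "\<And>i. i < n \<Longrightarrow> 0 < q i \<and> q i < 1" and \<nu>1: "sum \<nu> (cube n) = 1"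
  shows "(\<Sum>y\<in>cube n. \<nu> y * ln (pw n q y))
    = (\<Sum>i<n. (ln (q i) + ln (1 - q i)) / 2 + (ln (q i) - ln (1 - q i)) / 2 * (\<Sum>y\<in>cube n. \<nu> y * y i))"
proof -
  have "(\<Sum>y\<in>cube n. \<nu> y * ln (pw n q y))
      = (\<Sum>y\<in>cube n. \<Sum>i<n. (ln (q i) + ln (1 - q i)) / 2 * \<nu> y + (ln (q i) - ln (1 - q i)) / 2 * (\<nu> y * y i))"
    by (intro sum.cong) (auto simp: ln_pw[OF _ q] sum_distrib_left algebra_simps)
  also have "\<dots> = (\<Sum>i<n. \<Sum>y\<in>cube n. (ln (q i) + ln (1 - q i)) / 2 * \<nu> y + (ln (q i) - ln (1 - q i)) / 2 * (\<nu> y * y i))"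
    by (rule sum.swap)
  also have "\<dots> = (\<Sum>i<n. (ln (q i) + ln (1 - q i)) / 2 + (ln (q i) - ln (1 - q i)) / 2 * (\<Sum>y\<in>cube n. \<nu> y * y i))"
    by (simp only: sum.distrib sum_distrib_left[symmetric] \<nu>1 mult_1_right)
  finally show ?thesis .
qed

lemma KL_pos_eq:
  assumes "\<And>y. y \<in> cube n \<Longrightarrow> 0 < \<nu> y" "\<And>y. y \<in> cube n \<Longrightarrow> 0 < \<xi> y"
  shows "KL n \<nu> \<xi> = (\<Sum>y\<in>cube n. \<nu> y * ln (\<nu> y)) - (\<Sum>y\<in>cube n. \<nu> y * ln (\<xi> y))"
  unfolding KL_def sum_subtractf[symmetric]
proof (rule sum.cong)
  fix y assume "y \<in> cube n"
  then have "0 < \<nu> y" "0 < \<xi> y" using assms by auto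
  then show "(if \<nu> y = 0 then 0 else \<nu> y * ln (\<nu> y / \<xi> y)) = \<nu> y * ln (\<nu> y) - \<nu> y * ln (\<xi> y)"
    by (simp add: ln_div algebra_simps)
qed simp

lemma KL_nonneg:
  assumes "\<And>y. y \<in> cube n \<Longrightarrow> 0 \<le> \<nu> y" "\<And>y. y \<in> cube n \<Longrightarrow> 0 < \<xi> y"
    and "sum \<nu> (cube n) = 1" "sum \<xi> (cube n) = 1"
  shows "0 \<le> KL n \<nu> \<xi>"
  using gibbs_variational[of "cube n" \<nu> \<xi> "\<lambda>_. 0"] assms by (simp add: KL_def)

lemma KL_mu_p: "KL n \<nu> (mu_p n p) = KL n \<nu> (pw n (\<lambda>_. p))"
  unfolding KL_def by (intro sum.cong) (auto simp: mu_p_eq_pw)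

text \<open>A Pythagorean identity: measures with equal marginals integrate log product weights
  equally, so KL(\<nu> | p) = KL(\<nu> | q) + KL(q | p), and the first summand is
  nonnegative.\<close>

lemma KL_marginals_le:
  assumes \<nu>: "\<And>y. 0 < \<nu> y" and \<nu>1: "sum \<nu> (cube n) = 1"
    and p: "\<And>i. i < n \<Longrightarrow> 0 < p i \<and> p i < 1"
  defines "q \<equiv> \<lambda>i. (1 + (\<Sum>y\<in>cube n. \<nu> y * y i)) / 2"
  shows "KL n (pw n q) (pw n p) \<le> KL n \<nu> (pw n p)"
proof -
  have q: "0 < q i \<and> q i < 1" if "i < n" for i
    unfolding q_def using marginal_bounds[OF that \<nu> \<nu>1] .
  have w: "0 < pw n q y" for y using q by (rule pw_pos)
  have wp: "0 < pw n p y" for y using p by (rule pw_pos)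
  have m: "(\<Sum>y\<in>cube n. pw n q y * y i) = (\<Sum>y\<in>cube n. \<nu> y * y i)" if "i < n" for i
    by (simp add: sum_pw_coord[OF that]) (simp add: q_def add_divide_distrib)
  have same: "(\<Sum>y\<in>cube n. \<nu> y * ln (pw n r y)) = (\<Sum>y\<in>cube n. pw n q y * ln (pw n r y))"
    if "\<And>i. i < n \<Longrightarrow> 0 < r i \<and> r i < 1" for r
    by (simp add: sum_ln_pw[OF that \<nu>1] sum_ln_pw[OF that sum_pw] m)
  have "0 \<le> KL n \<nu> (pw n q)"
    by (rule KL_nonneg) (use \<nu> w \<nu>1 in \<open>auto simp: sum_pw less_imp_le\<close>)
  then show ?thesis
    using \<nu> w wp by (simp add: KL_pos_eq same[OF q] same[OF p])
qed

lemma ln_le_of_le_exp: "0 < x \<Longrightarrow> x \<le> exp y \<Longrightarrow> ln x \<le> (y :: real)"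
  by (metis exp_gt_zero ln_exp ln_le_cancel_iff)

section \<open>Exponential tilts and the mean-field bound for a fixed tilt\<close>

definition tilt :: "nat \<Rightarrow> ((nat \<Rightarrow> real) \<Rightarrow> real) \<Rightarrow> (nat \<Rightarrow> real) \<Rightarrow> (nat \<Rightarrow> real) \<Rightarrow> real" where
  "tilt n b W y = b y * exp (\<Sum>i<n. W i * y i) / (\<Sum>z\<in>cube n. b z * exp (\<Sum>i<n. W i * z i))"

lemma tilt_pos: "(\<And>y. 0 < b y) \<Longrightarrow> 0 < tilt n b W y"
  unfolding tilt_def by (intro divide_pos_pos mult_pos_pos sum_pos) auto

lemma sum_tilt: "(\<And>y. 0 < b y) \<Longrightarrow> sum (tilt n b W) (cube n) = 1"
proof -
  assume "\<And>y. 0 < b y"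
  then have "0 < (\<Sum>z\<in>cube n. b z * exp (\<Sum>i<n. W i * z i))" by (intro sum_pos) auto
  then show ?thesis by (simp add: tilt_def sum_divide_distrib[symmetric])
qed

text \<open>The witness \<open>q\<close> consists of the marginals of the tilted measure. Jensen
  bounds the free energy by that of the tilted measure, which is expressed exactly through its
  relative entropy. Passing to the product of marginals only lowers this entropy, and a transport
  inequality controls the change in the mean of \<open>g\<close>.\<close>

lemma mean_field_step:
  fixes g :: "(nat \<Rightarrow> real) \<Rightarrow> real"
  assumes p: "0 < p" "p < 1" and \<kappa>: "0 < \<kappa>"
    and g: "\<And>y i. y \<in> cube n \<Longrightarrow> i < n \<Longrightarrow> \<bar>pd i g y\<bar> \<le> l"
  defines "\<nu> \<equiv> tilt n (\<lambda>y. pw n (\<lambda>_. p) y * exp (g y))"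
  shows "\<exists>q. (\<forall>i<n. 0 < q i \<and> q i < 1) \<and>
    ln (\<Sum>y\<in>cube n. pw n (\<lambda>_. p) y * exp (g y))
      \<le> (\<Sum>y\<in>cube n. pw n q y * g y) - KL n (pw n q) (pw n (\<lambda>_. p))
        + (\<Sum>i<n. W i * ((\<Sum>y\<in>cube n. \<nu> W y * y i) - (\<Sum>y\<in>cube n. \<nu> (\<lambda>_. 0) y * y i)))
        + (\<Sum>i<n. cov n (\<nu> W) (pd i g) (\<lambda>y. y i)) / \<kappa> + \<kappa> * real n * l\<^sup>2 / 2"
proof -
  define b where "b y = pw n (\<lambda>_. p) y * exp (g y)" for y
  define ip where "ip W y = (\<Sum>i<n. W i * y i)" for W y :: "nat \<Rightarrow> real"
  define Z where "Z W = (\<Sum>y\<in>cube n. b y * exp (ip W y))" for W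
  have wp: "0 < pw n (\<lambda>_. p) y" for y using p by (intro pw_pos) auto
  have b: "0 < b y" for y by (simp add: b_def wp)
  have Z: "0 < Z W" for W unfolding Z_def using b by (intro sum_pos) auto
  have \<nu>: "0 < \<nu> W y" and \<nu>1: "sum (\<nu> W) (cube n) = 1" for W y
    unfolding \<nu>_def b_def[symmetric] by (intro tilt_pos sum_tilt b)+
  have \<nu>_eq: "\<nu> W y = b y * exp (ip W y) / Z W" for W y
    by (simp add: \<nu>_def tilt_def Z_def b_def ip_def)
  have ln\<nu>: "ln (\<nu> W y) = ln (pw n (\<lambda>_. p) y) + g y + ip W y - ln (Z W)" for W y
    using wp[of y] Z[of W] by (simp add: \<nu>_eq b_def ln_div ln_mult)
  have sum_ip: "(\<Sum>y\<in>cube n. \<xi> y * ip W y) = (\<Sum>i<n. W i * (\<Sum>y\<in>cube n. \<xi> y * y i))" for \<xi> W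
    unfolding ip_def sum_distrib_left by (subst sum.swap) (simp add: algebra_simps)
  define q where "q i = (1 + (\<Sum>y\<in>cube n. \<nu> W y * y i)) / 2" for i
  have q: "0 < q i \<and> q i < 1" if "i < n" for i
    unfolding q_def using marginal_bounds[OF that \<nu> \<nu>1] .
  have w: "0 < pw n q y" for y using q by (rule pw_pos)
  have "KL n (\<nu> W) (pw n q) \<le> (\<Sum>i<n. cov n (\<nu> W) (pd i (\<lambda>y. ln (\<nu> W y))) (\<lambda>y. y i))"
    unfolding q_def[abs_def] using \<nu> \<nu>1 by (rule KL_product_marginals_le)
  also have "\<dots> = (\<Sum>i<n. cov n (\<nu> W) (pd i g) (\<lambda>y. y i))"
  proof (rule sum.cong)
    fix i assume i: "i \<in> {..<n}"
    let ?R = "\<lambda>y. \<Prod>j\<in>{..<n} - {i}. if y j = 1 then p else 1 - p"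
    \<comment> \<open>The product weight and the linear tilt contribute only a constant to the
      discrete derivative of the log density, which the covariance ignores.\<close>
    have "pd i (\<lambda>y. ln (\<nu> W y)) y = pd i g y + ((ln p - ln (1 - p)) / 2 + W i)" for y
    proof -
      have R: "0 < ?R y" using p by (intro prod_pos) auto
      have pwp: "ln (pw n (\<lambda>_. p) (y(i := 1))) = ln p + ln (?R y)"
        and pwm: "ln (pw n (\<lambda>_. p) (y(i := - 1))) = ln (1 - p) + ln (?R y)"
        using pw_upd[of i n "\<lambda>_. p" y] i p R by (auto simp: ln_mult)
      have "ip W (y(i := c)) = W i * c + (\<Sum>j\<in>{..<n} - {i}. W j * y j)" for c
        unfolding ip_def using i by (subst sum.remove[of _ i]) (auto intro!: sum.cong)
      then show ?thesis unfolding pd_def ln\<nu> pwp pwm by (simp add: field_simps)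
    qed
    then show "cov n (\<nu> W) (pd i (\<lambda>y. ln (\<nu> W y))) (\<lambda>y. y i) = cov n (\<nu> W) (pd i g) (\<lambda>y. y i)"
      using \<nu>1 by (intro cov_add_const) auto
  qed simp
  finally have KL1: "KL n (\<nu> W) (pw n q) \<le> (\<Sum>i<n. cov n (\<nu> W) (pd i g) (\<lambda>y. y i))" .
  \<comment> \<open>Transport inequality: the Gibbs principle for \<open>\<kappa> * g\<close> is
    combined with the bounded difference inequality under the product measure, then divided by
    \<open>\<kappa>\<close>.\<close>
  have "(\<Sum>y\<in>cube n. pw n q y * exp (\<kappa> * g y))
      \<le> exp ((\<Sum>y\<in>cube n. pw n q y * (\<kappa> * g y)) + real n * (\<kappa> * l)\<^sup>2 / 2)"
  proof (rule bounded_differences_mgf)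
    fix y i assume "y \<in> cube n" "i < n"
    from g[OF this] have "\<bar>g (y(i := 1)) - g (y(i := - 1))\<bar> \<le> 2 * l" by (simp add: pd_def)
    then show "\<bar>\<kappa> * g (y(i := 1)) - \<kappa> * g (y(i := - 1))\<bar> \<le> 2 * (\<kappa> * l)"
      using \<kappa> by (simp add: right_diff_distrib[symmetric] abs_mult)
  qed (use q in \<open>auto simp: less_imp_le\<close>)
  then have "ln (\<Sum>y\<in>cube n. pw n q y * exp (\<kappa> * g y))
      \<le> (\<Sum>y\<in>cube n. pw n q y * (\<kappa> * g y)) + real n * (\<kappa> * l)\<^sup>2 / 2"
    by (rule ln_le_of_le_exp[rotated]) (use w in \<open>auto intro!: sum_pos\<close>)
  moreover have "(\<Sum>y\<in>cube n. \<nu> W y * (\<kappa> * g y))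
      \<le> KL n (\<nu> W) (pw n q) + ln (\<Sum>y\<in>cube n. pw n q y * exp (\<kappa> * g y))"
    unfolding KL_def by (rule gibbs_variational) (use \<nu> w \<nu>1 in \<open>auto simp: less_imp_le\<close>)
  ultimately have "\<kappa> * (\<Sum>y\<in>cube n. \<nu> W y * g y)
      \<le> (\<Sum>i<n. cov n (\<nu> W) (pd i g) (\<lambda>y. y i)) + \<kappa> * (\<Sum>y\<in>cube n. pw n q y * g y) + real n * (\<kappa> * l)\<^sup>2 / 2"
    using KL1 by (simp add: sum_distrib_left mult.left_commute)
  then have transport: "(\<Sum>y\<in>cube n. \<nu> W y * g y) \<le> (\<Sum>y\<in>cube n. pw n q y * g y)
      + (\<Sum>i<n. cov n (\<nu> W) (pd i g) (\<lambda>y. y i)) / \<kappa> + \<kappa> * real n * l\<^sup>2 / 2"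
    using \<kappa> by (simp add: field_simps power2_eq_square)
  have KL2: "KL n (pw n q) (pw n (\<lambda>_. p)) \<le> KL n (\<nu> W) (pw n (\<lambda>_. p))"
    unfolding q_def[abs_def] using \<nu> \<nu>1 by (rule KL_marginals_le) (use p in auto)
  have "(\<Sum>y\<in>cube n. \<nu> W y * ln (\<nu> W y)) = (\<Sum>y\<in>cube n. \<nu> W y * ln (pw n (\<lambda>_. p) y))
      + (\<Sum>y\<in>cube n. \<nu> W y * g y) + (\<Sum>y\<in>cube n. \<nu> W y * ip W y) - ln (Z W) * sum (\<nu> W) (cube n)"
    unfolding sum_distrib_left sum_subtractf[symmetric] sum.distrib[symmetric] ln\<nu>
    by (intro sum.cong) (auto simp: algebra_simps)
  then have KL3: "KL n (\<nu> W) (pw n (\<lambda>_. p)) = (\<Sum>y\<in>cube n. \<nu> W y * g y) + (\<Sum>y\<in>cube n. \<nu> W y * ip W y) - ln (Z W)"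
    using \<nu> wp by (simp add: KL_pos_eq \<nu>1)
  \<comment> \<open>With both measures equal, the Gibbs principle reduces to Jensen's inequality for
    the ratio of partition functions.\<close>
  have "(\<Sum>y\<in>cube n. \<nu> (\<lambda>_. 0) y * ip W y) \<le> KL n (\<nu> (\<lambda>_. 0)) (\<nu> (\<lambda>_. 0)) + ln (\<Sum>y\<in>cube n. \<nu> (\<lambda>_. 0) y * exp (ip W y))"
    unfolding KL_def by (rule gibbs_variational) (use \<nu> \<nu>1 in \<open>auto simp: less_imp_le\<close>)
  also have "KL n (\<nu> (\<lambda>_. 0)) (\<nu> (\<lambda>_. 0)) = 0" using \<nu> by (simp add: KL_pos_eq)
  also have "(\<Sum>y\<in>cube n. \<nu> (\<lambda>_. 0) y * exp (ip W y)) = Z W / Z (\<lambda>_. 0)"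
    unfolding \<nu>_eq Z_def[of W] sum_divide_distrib by (simp add: ip_def)
  also have "ln (Z W / Z (\<lambda>_. 0)) = ln (Z W) - ln (Z (\<lambda>_. 0))"
    using Z[of W] Z[of "\<lambda>_. 0"] by (simp add: ln_div)
  finally have low: "ln (Z (\<lambda>_. 0)) \<le> ln (Z W) - (\<Sum>y\<in>cube n. \<nu> (\<lambda>_. 0) y * ip W y)" by simp
  have "ln (Z (\<lambda>_. 0)) \<le> (\<Sum>y\<in>cube n. pw n q y * g y) - KL n (pw n q) (pw n (\<lambda>_. p))
        + ((\<Sum>y\<in>cube n. \<nu> W y * ip W y) - (\<Sum>y\<in>cube n. \<nu> (\<lambda>_. 0) y * ip W y))
        + (\<Sum>i<n. cov n (\<nu> W) (pd i g) (\<lambda>y. y i)) / \<kappa> + \<kappa> * real n * l\<^sup>2 / 2"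
    using low KL3 KL2 transport by linarith
  then have "ln (Z (\<lambda>_. 0)) \<le> (\<Sum>y\<in>cube n. pw n q y * g y) - KL n (pw n q) (pw n (\<lambda>_. p))
        + (\<Sum>i<n. W i * ((\<Sum>y\<in>cube n. \<nu> W y * y i) - (\<Sum>y\<in>cube n. \<nu> (\<lambda>_. 0) y * y i)))
        + (\<Sum>i<n. cov n (\<nu> W) (pd i g) (\<lambda>y. y i)) / \<kappa> + \<kappa> * real n * l\<^sup>2 / 2"
    by (simp add: sum_ip right_diff_distrib sum_subtractf)
  moreover have "Z (\<lambda>_. 0) = (\<Sum>y\<in>cube n. pw n (\<lambda>_. p) y * exp (g y))"
    by (simp add: Z_def ip_def b_def)
  ultimately show ?thesis using q by auto
qed

section \<open>Gaussian integration by parts and Gaussian width\<close>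

abbreviation std_normal :: "real measure" where
  "std_normal \<equiv> density lborel std_normal_density"

lemma prob_space_std_normal: "prob_space std_normal"
  using prob_space_normal_density[of 1 0] by simp

lemma has_derivative_std_normal_density:
  "(std_normal_density has_real_derivative - x * std_normal_density x) (at x)"
proof -
  have "((\<lambda>x. exp (- x\<^sup>2 / 2)) has_real_derivative - x * exp (- x\<^sup>2 / 2)) (at x)"
    by (auto intro!: derivative_eq_intros)
  from DERIV_cmult[OF this, of "1 / sqrt (2 * pi)"] show ?thesis
    unfolding std_normal_density_def[abs_def] by (simp add: mult_ac)
qed

lemma std_normal_density_tendsto:
  "(std_normal_density \<longlongrightarrow> 0) at_top" "(std_normal_density \<longlongrightarrow> 0) at_bot"
proof -
  have "filterlim (\<lambda>x::real. x * x) at_top at_top"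
    by (rule filterlim_at_top_mult_at_top) (rule filterlim_ident)+
  then have *: "filterlim (\<lambda>x::real. x\<^sup>2 / 2) at_top at_top"
    using filterlim_tendsto_pos_mult_at_top[OF tendsto_const, of "1/2 :: real" "\<lambda>x. x * x" at_top]
    by (simp add: power2_eq_square)
  have "((\<lambda>x::real. exp (- (x\<^sup>2 / 2))) \<longlongrightarrow> 0) at_top"
    by (rule filterlim_compose[OF exp_at_bot])
       (rule filterlim_compose[OF filterlim_uminus_at_bot_at_top *])
  from tendsto_mult_right_zero[OF this, of "1 / sqrt (2 * pi)"]
  show top: "(std_normal_density \<longlongrightarrow> 0) at_top"
    by (simp add: std_normal_density_def[abs_def])
  then show "(std_normal_density \<longlongrightarrow> 0) at_bot"
    unfolding at_bot_mirror filterlim_filtermap by (simp add: std_normal_density_def[abs_def])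
qed

text \<open>Stein's identity: minus the density times \<open>h\<close> has derivative
  \<open>F'\<close>, and it vanishes at both infinities because \<open>h\<close> is bounded.\<close>

lemma std_normal_integration_by_parts:
  fixes h h' :: "real \<Rightarrow> real"
  assumes deriv: "\<And>x. (h has_real_derivative h' x) (at x)"
    and cont: "continuous_on UNIV h'"
    and bound: "\<And>x. \<bar>h x\<bar> \<le> B" and bound': "\<And>x. \<bar>h' x\<bar> \<le> B'"
  shows "(\<integral>x. x * h x \<partial>std_normal) = (\<integral>x. h' x \<partial>std_normal)"
proof -
  let ?\<phi> = std_normal_density
  have [measurable]: "h \<in> borel_measurable borel"
    using deriv by (intro borel_measurable_continuous_onI) (meson DERIV_isCont continuous_at_imp_continuous_on)
  have [measurable]: "h' \<in> borel_measurable borel"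
    using cont by (rule borel_measurable_continuous_onI)
  have i1: "integrable lborel (\<lambda>x. ?\<phi> x * (x * h x))"
  proof (rule Bochner_Integration.integrable_bound)
    show "integrable lborel (\<lambda>x. B * (?\<phi> x * \<bar>x\<bar> ^ 1))"
      by (intro integrable_mult_right integrable_std_normal_moment_abs)
    show "AE x in lborel. norm (?\<phi> x * (x * h x)) \<le> norm (B * (?\<phi> x * \<bar>x\<bar> ^ 1))"
    proof (rule AE_I2)
      fix x
      have "\<bar>h x\<bar> * (?\<phi> x * \<bar>x\<bar>) \<le> \<bar>B\<bar> * (?\<phi> x * \<bar>x\<bar>)"
        using bound[of x] by (intro mult_right_mono) auto
      then show "norm (?\<phi> x * (x * h x)) \<le> norm (B * (?\<phi> x * \<bar>x\<bar> ^ 1))"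
        by (simp add: abs_mult mult_ac)
    qed
  qed simp
  have i2: "integrable lborel (\<lambda>x. ?\<phi> x * h' x)"
  proof (rule Bochner_Integration.integrable_bound)
    show "integrable lborel (\<lambda>x. B' * (?\<phi> x * \<bar>x\<bar> ^ 0))"
      by (intro integrable_mult_right integrable_std_normal_moment_abs)
    show "AE x in lborel. norm (?\<phi> x * h' x) \<le> norm (B' * (?\<phi> x * \<bar>x\<bar> ^ 0))"
    proof (rule AE_I2)
      fix x
      have "\<bar>h' x\<bar> * ?\<phi> x \<le> \<bar>B'\<bar> * ?\<phi> x"
        using bound'[of x] by (intro mult_right_mono) auto
      then show "norm (?\<phi> x * h' x) \<le> norm (B' * (?\<phi> x * \<bar>x\<bar> ^ 0))"
        by (simp add: abs_mult mult_ac)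
    qed
  qed simp
  define F where "F x = - (?\<phi> x * h x)" for x
  define F' where "F' x = ?\<phi> x * (x * h x) - ?\<phi> x * h' x" for x
  have lim0: "(F \<longlongrightarrow> 0) G" if "(?\<phi> \<longlongrightarrow> 0) G" for G
  proof (rule Lim_null_comparison)
    show "\<forall>\<^sub>F x in G. norm (F x) \<le> B * ?\<phi> x"
    proof (rule always_eventually, rule allI)
      fix x show "norm (F x) \<le> B * ?\<phi> x"
        using mult_right_mono[OF bound[of x], of "?\<phi> x"] by (simp add: F_def abs_mult mult.commute)
    qed
    show "((\<lambda>x. B * ?\<phi> x) \<longlongrightarrow> 0) G" using that by (rule tendsto_mult_right_zero)
  qed
  have "(LBINT x=-\<infinity>..\<infinity>. F' x) = 0 - 0"
  proof (rule interval_integral_FTC_integrable)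
    show "(F has_vector_derivative F' x) (at x)" for x
      unfolding has_real_derivative_iff_has_vector_derivative[symmetric] F_def F'_def
      by (auto intro!: derivative_eq_intros has_derivative_std_normal_density deriv simp: algebra_simps)
    show "isCont F' x" for x
    proof -
      have "isCont ?\<phi> x" "isCont h x"
        using DERIV_isCont has_derivative_std_normal_density deriv by blast+
      moreover have "isCont h' x" using cont by (simp add: continuous_on_eq_continuous_at)
      ultimately show ?thesis unfolding F'_def by (intro continuous_intros)
    qed
    show "set_integrable lborel (einterval (- \<infinity>) \<infinity>) F'"
      unfolding F'_def[abs_def] set_integrable_def using i1 i2 by simp
    show "((F \<circ> real_of_ereal) \<longlongrightarrow> 0) (at_right (- \<infinity>))"
      using lim0[OF std_normal_density_tendsto(2)] by (simp add: ereal_tendsto_simps)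
    show "((F \<circ> real_of_ereal) \<longlongrightarrow> 0) (at_left \<infinity>)"
      using lim0[OF std_normal_density_tendsto(1)] by (simp add: ereal_tendsto_simps)
  qed simp
  then have "(\<integral>x. F' x \<partial>lborel) = 0"
    by (simp add: interval_lebesgue_integral_def set_lebesgue_integral_def)
  then have "(\<integral>x. ?\<phi> x * (x * h x) \<partial>lborel) = (\<integral>x. ?\<phi> x * h' x \<partial>lborel)"
    unfolding F'_def using i1 i2 by simp
  then show ?thesis by (simp add: integral_density)
qed

section \<open>The Gaussian measure in dimension n\<close>

lemma prob_space_gauss: "prob_space (gauss n)"
  unfolding gauss_def by (intro prob_space_PiM prob_space_std_normal)

lemma sets_gauss: "sets (gauss n) = sets (PiM {..<n} (\<lambda>_. borel))"
  unfolding gauss_def by (intro sets_PiM_cong) auto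

lemma measurable_gauss_component [measurable]: "i < n \<Longrightarrow> (\<lambda>x. x i) \<in> borel_measurable (gauss n)"
  unfolding measurable_cong_sets[OF sets_gauss refl] by (rule measurable_component_singleton) simp

lemma distr_gauss_component:
  assumes "i < n"
  shows "distr (gauss n) std_normal (\<lambda>x. x i) = std_normal"
  unfolding gauss_def
  by (rule distr_PiM_component[of "{..<n}" "\<lambda>_. std_normal" i]) (use assms prob_space_std_normal in auto)

lemma integral_gauss_component:
  fixes F :: "real \<Rightarrow> real"
  assumes "i < n" and [measurable]: "F \<in> borel_measurable borel"
  shows "integrable (gauss n) (\<lambda>x. F (x i)) \<longleftrightarrow> integrable std_normal F"
    and "(\<integral>x. F (x i) \<partial>gauss n) = (\<integral>x. F x \<partial>std_normal)"
proof -
  have m: "(\<lambda>x. x i) \<in> measurable (gauss n) std_normal"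
    using measurable_gauss_component[OF assms(1)] by simp
  have F: "F \<in> borel_measurable std_normal" using assms by simp
  show "integrable (gauss n) (\<lambda>x. F (x i)) \<longleftrightarrow> integrable std_normal F"
    using integrable_distr_eq[OF m F] distr_gauss_component[OF assms(1)] by simp
  show "(\<integral>x. F (x i) \<partial>gauss n) = (\<integral>x. F x \<partial>std_normal)"
    using integral_distr[OF m F] distr_gauss_component[OF assms(1)] by simp
qed

lemma integrable_std_normal: "integrable std_normal (\<lambda>x. x)" "integrable std_normal (\<lambda>x. \<bar>x\<bar>)"
proof -
  have "integrable lborel (\<lambda>x. std_normal_density x * x ^ 1)" "integrable lborel (\<lambda>x. std_normal_density x * \<bar>x\<bar> ^ 1)"
    by (rule integrable_std_normal_moment integrable_std_normal_moment_abs)+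
  then show "integrable std_normal (\<lambda>x. x)" "integrable std_normal (\<lambda>x. \<bar>x\<bar>)"
    by (auto simp: integrable_density)
qed

lemma integrable_gauss_component:
  assumes "i < n"
  shows "integrable (gauss n) (\<lambda>x. x i)" "integrable (gauss n) (\<lambda>x. \<bar>x i\<bar>)"
  by (rule iffD2[OF integral_gauss_component(1)[OF assms, of "\<lambda>x. x"]] iffD2[OF integral_gauss_component(1)[OF assms, of abs]],
      simp, rule integrable_std_normal)+

text \<open>Unit variance together with |x| <= (1 + x^2) / 2.\<close>

lemma gauss_abs_moment_le: "i < n \<Longrightarrow> (\<integral>x. \<bar>x i\<bar> \<partial>gauss n) \<le> 1"
proof -
  assume i: "i < n"
  interpret N: prob_space std_normal by (rule prob_space_std_normal)
  have m2: "integrable std_normal (\<lambda>x. x\<^sup>2)"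
    using integrable_std_normal_moment[of 2] by (simp add: integrable_density)
  have "(\<integral>x. x\<^sup>2 \<partial>std_normal) = 1"
    using integral_std_normal_moment_even[of 1] by (simp add: integral_density)
  moreover have "(\<integral>x. \<bar>x\<bar> \<partial>std_normal) \<le> (\<integral>x. (1 + x\<^sup>2) / 2 \<partial>std_normal)"
  proof (rule integral_mono)
    fix x :: real
    have "0 \<le> (\<bar>x\<bar> - 1)\<^sup>2" by simp
    then show "\<bar>x\<bar> \<le> (1 + x\<^sup>2) / 2" by (simp add: power2_diff)
  qed (use integrable_std_normal m2 in auto)
  moreover have "(\<integral>x. (1 + x\<^sup>2) / 2 \<partial>std_normal) = (1 + (\<integral>x. x\<^sup>2 \<partial>std_normal)) / 2"
    using m2 N.prob_space by simp
  ultimately show ?thesis using integral_gauss_component(2)[OF i, of abs] by simp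
qed

lemma integrable_gauss_bounded:
  fixes u :: "(nat \<Rightarrow> real) \<Rightarrow> real"
  assumes [measurable]: "u \<in> borel_measurable (gauss n)" and "\<And>x. \<bar>u x\<bar> \<le> B"
  shows "integrable (gauss n) u"
proof -
  interpret prob_space "gauss n" by (rule prob_space_gauss)
  show ?thesis using assms by (intro integrable_const_bound[of _ B]) auto
qed

lemma integrable_gauss_component_mult:
  fixes u :: "(nat \<Rightarrow> real) \<Rightarrow> real"
  assumes i: "i < n" and [measurable]: "u \<in> borel_measurable (gauss n)" and B: "\<And>x. \<bar>u x\<bar> \<le> B"
  shows "integrable (gauss n) (\<lambda>x. x i * u x)"
proof (rule Bochner_Integration.integrable_bound)
  show "integrable (gauss n) (\<lambda>x. B * \<bar>x i\<bar>)"
    using integrable_gauss_component[OF i] by simp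
  show "(\<lambda>x. x i * u x) \<in> borel_measurable (gauss n)"
    using measurable_gauss_component[OF i] by simp
  show "AE x in gauss n. norm (x i * u x) \<le> norm (B * \<bar>x i\<bar>)"
  proof (rule AE_I2)
    fix x :: "nat \<Rightarrow> real"
    have "\<bar>u x\<bar> * \<bar>x i\<bar> \<le> \<bar>B\<bar> * \<bar>x i\<bar>" using B[of x] by (intro mult_right_mono) auto
    then show "norm (x i * u x) \<le> norm (B * \<bar>x i\<bar>)" by (simp add: abs_mult mult.commute)
  qed
qed

text \<open>Fubini isolates coordinate \<open>i\<close>, and the one-dimensional identity is applied
  on each line parallel to that axis.\<close>

lemma gauss_integration_by_parts:
  fixes u u' :: "(nat \<Rightarrow> real) \<Rightarrow> real"
  assumes i: "i < n"
    and u: "u \<in> borel_measurable (gauss n)" "\<And>x. \<bar>u x\<bar> \<le> B"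
    and u': "u' \<in> borel_measurable (gauss n)" "\<And>x. \<bar>u' x\<bar> \<le> B'"
    and deriv: "\<And>x t. ((\<lambda>t. u (x(i := t))) has_real_derivative u' (x(i := t))) (at t)"
    and cont: "\<And>x. continuous_on UNIV (\<lambda>t. u' (x(i := t)))"
  shows "(\<integral>x. x i * u x \<partial>gauss n) = (\<integral>x. u' x \<partial>gauss n)"
proof -
  interpret N: prob_space std_normal by (rule prob_space_std_normal)
  interpret product_sigma_finite "\<lambda>_::nat. std_normal" by standard
  have I: "insert i ({..<n} - {i}) = {..<n}" using i by auto
  note ins = product_integral_insert[of "{..<n} - {i}" i, unfolded I, folded gauss_def]
  have "(\<integral>x. x i * u x \<partial>gauss n)
      = (\<integral>x. (\<integral>t. t * u (x(i := t)) \<partial>std_normal) \<partial>PiM ({..<n} - {i}) (\<lambda>_. std_normal))"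
    using ins[OF _ _ integrable_gauss_component_mult[OF i u]] by simp
  also have "\<dots> = (\<integral>x. (\<integral>t. u' (x(i := t)) \<partial>std_normal) \<partial>PiM ({..<n} - {i}) (\<lambda>_. std_normal))"
    by (intro Bochner_Integration.integral_cong refl std_normal_integration_by_parts[OF deriv cont u(2) u'(2)])
  also have "\<dots> = (\<integral>x. u' x \<partial>gauss n)"
    using ins[OF _ _ integrable_gauss_bounded[OF u']] by simp
  finally show ?thesis .
qed

text \<open>Adding a point to the finite set \<open>K\<close> replaces the supremum by a maximum of
  two integrable functions.\<close>

lemma integrable_Sup_linear:
  fixes K :: "(nat \<Rightarrow> real) set"
  assumes "finite K" "K \<noteq> {}"
  shows "integrable (gauss n) (\<lambda>\<Gamma>. Sup ((\<lambda>x. \<Sum>i<n. x i * \<Gamma> i) ` K))"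
  using assms
proof (induction K rule: finite_ne_induct)
  case (singleton x)
  show ?case unfolding image_insert image_empty cSup_singleton
    by (intro Bochner_Integration.integrable_sum integrable_mult_right) (simp add: integrable_gauss_component)
next
  case (insert x K)
  have "Sup ((\<lambda>x. \<Sum>i<n. x i * \<Gamma> i) ` insert x K)
      = max (\<Sum>i<n. x i * \<Gamma> i) (Sup ((\<lambda>x. \<Sum>i<n. x i * \<Gamma> i) ` K))" for \<Gamma>
    using insert by (simp add: cSup_insert bdd_above_finite sup_max)
  moreover have "integrable (gauss n) (\<lambda>\<Gamma>. \<Sum>i<n. x i * \<Gamma> i)"
    by (intro Bochner_Integration.integrable_sum integrable_mult_right) (simp add: integrable_gauss_component)
  ultimately show ?case using insert.IH by simp
qed

lemma Sup_linear_upper: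
  fixes \<Gamma> :: "nat \<Rightarrow> real"
  assumes "finite K" "x \<in> K"
  shows "(\<Sum>i<n. x i * \<Gamma> i) \<le> Sup ((\<lambda>x. \<Sum>i<n. x i * \<Gamma> i) ` K)"
  using assms by (intro cSup_upper bdd_above_finite) auto

lemma DD_nonneg: "0 \<le> DD n g"
  unfolding DD_def GW_def
proof (rule Bochner_Integration.integral_nonneg)
  fix \<Gamma> :: "nat \<Rightarrow> real"
  have "(\<Sum>i<n. (\<lambda>_. 0) i * \<Gamma> i) \<le> Sup ((\<lambda>x. \<Sum>i<n. x i * \<Gamma> i) ` (grad n g ` cube n \<union> {\<lambda>_. 0}))"
    by (rule Sup_linear_upper) auto
  then show "0 \<le> Sup ((\<lambda>x. \<Sum>i<n. x i * \<Gamma> i) ` (grad n g ` cube n \<union> {\<lambda>_. 0}))" by simp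
qed

section \<open>The mean-field approximation\<close>

text \<open>Quotient rule for an exponential family: the logarithmic derivative of the normalised
  weight is the centred coordinate, times \<open>r\<close> from the scaling of the tilt.\<close>

lemma tilt_has_derivative:
  fixes \<Gamma> :: "nat \<Rightarrow> real" and r :: real
  assumes b: "\<And>y. 0 < b y" and i: "i < n"
  defines "W \<equiv> \<lambda>t j. r * ((\<Gamma>(i := t)) j)"
  shows "((\<lambda>t. tilt n b (W t) y) has_real_derivative
           r * (y i - (\<Sum>z\<in>cube n. tilt n b (W t) z * z i)) * tilt n b (W t) y) (at t)"
proof -
  define N where "N t y = b y * exp (\<Sum>j<n. W t j * y j)" for t and y :: "nat \<Rightarrow> real"
  define S where "S t = (\<Sum>z\<in>cube n. N t z)" for t
  have S: "0 < S t" for t unfolding S_def N_def using b by (intro sum_pos) auto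
  have tilt: "tilt n b (W t) y = N t y / S t" for t y by (simp add: tilt_def N_def S_def)
  have ip: "(\<Sum>j<n. W t j * y j) = r * t * y i + (\<Sum>j\<in>{..<n} - {i}. r * \<Gamma> j * y j)" for t and y :: "nat \<Rightarrow> real"
    unfolding W_def using i by (subst sum.remove[of _ i]) (auto intro!: sum.cong)
  have dN: "((\<lambda>t. N t y) has_real_derivative r * y i * N t y) (at t)" for t y
    unfolding N_def ip by (auto intro!: derivative_eq_intros)
  have dS: "(S has_real_derivative (\<Sum>z\<in>cube n. r * z i * N t z)) (at t)" for t
    unfolding S_def[abs_def] by (rule DERIV_sum) (rule dN)
  have "((\<lambda>t. N t y / S t) has_real_derivative
      (r * y i * N t y * S t - N t y * (\<Sum>z\<in>cube n. r * z i * N t z)) / (S t * S t)) (at t)"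
    by (rule DERIV_divide[OF dN dS]) (use S[of t] in simp)
  moreover have "(\<Sum>z\<in>cube n. r * z i * N t z) = r * S t * (\<Sum>z\<in>cube n. N t z / S t * z i)"
    unfolding sum_distrib_left using S[of t] by (intro sum.cong) auto
  then have "(r * y i * N t y * S t - N t y * (\<Sum>z\<in>cube n. r * z i * N t z)) / (S t * S t)
      = r * (y i - (\<Sum>z\<in>cube n. N t z / S t * z i)) * (N t y / S t)"
    using S[of t] by (simp add: field_simps)
  ultimately show ?thesis unfolding tilt by simp
qed

text \<open>Differentiating a mean in a natural parameter of the exponential family produces a
  covariance.\<close>

lemma tilt_mean_has_derivative:
  fixes r :: real
  assumes b: "\<And>y. 0 < b y" and i: "i < n"
  defines "\<nu> \<equiv> \<lambda>\<Gamma>. tilt n b (\<lambda>j. r * \<Gamma> j)"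
  shows "((\<lambda>t. \<Sum>y\<in>cube n. \<nu> (\<Gamma>(i := t)) y * a y) has_real_derivative
           r * cov n (\<nu> (\<Gamma>(i := t))) a (\<lambda>y. y i)) (at t)"
proof -
  define m where "m = (\<Sum>z\<in>cube n. \<nu> (\<Gamma>(i := t)) z * z i)"
  have "((\<lambda>t. \<Sum>y\<in>cube n. \<nu> (\<Gamma>(i := t)) y * a y) has_real_derivative
      (\<Sum>y\<in>cube n. r * (y i - m) * \<nu> (\<Gamma>(i := t)) y * a y)) (at t)"
    unfolding m_def \<nu>_def by (intro DERIV_sum DERIV_cmult_right tilt_has_derivative[OF b i])
  also have "(\<Sum>y\<in>cube n. r * (y i - m) * \<nu> (\<Gamma>(i := t)) y * a y)
      = r * ((\<Sum>y\<in>cube n. \<nu> (\<Gamma>(i := t)) y * (a y * y i)) - (\<Sum>y\<in>cube n. \<nu> (\<Gamma>(i := t)) y * a y) * m)"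
    unfolding sum_distrib_left sum_distrib_right sum_subtractf[symmetric]
    by (intro sum.cong) (auto simp: algebra_simps)
  finally show ?thesis unfolding cov_def m_def .
qed

lemma abs_mean_le:
  fixes a \<nu> :: "'a \<Rightarrow> real"
  assumes "\<And>y. y \<in> A \<Longrightarrow> 0 \<le> \<nu> y" "sum \<nu> A = 1" and "\<And>y. y \<in> A \<Longrightarrow> \<bar>a y\<bar> \<le> B"
  shows "\<bar>\<Sum>y\<in>A. \<nu> y * a y\<bar> \<le> B"
proof -
  have "\<bar>\<Sum>y\<in>A. \<nu> y * a y\<bar> \<le> (\<Sum>y\<in>A. \<bar>\<nu> y * a y\<bar>)" by (rule sum_abs)
  also have "\<dots> \<le> (\<Sum>y\<in>A. \<nu> y * B)"
    using assms by (intro sum_mono) (auto simp: abs_mult intro!: mult_left_mono)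
  finally show ?thesis using assms(2) by (simp add: sum_distrib_right[symmetric])
qed

lemma tilt_measurable:
  "(\<lambda>\<Gamma>. tilt n b (\<lambda>j. r * \<Gamma> j) y) \<in> borel_measurable (gauss n)"
proof -
  have [measurable]: "(\<lambda>\<Gamma>. \<Sum>i<n. r * \<Gamma> i * y i) \<in> borel_measurable (gauss n)" for y :: "nat \<Rightarrow> real"
    by (intro borel_measurable_sum borel_measurable_times measurable_gauss_component) auto
  show ?thesis unfolding tilt_def by measurable
qed

lemma cov_tilt_measurable:
  "(\<lambda>\<Gamma>. cov n (tilt n b (\<lambda>j. r * \<Gamma> j)) a c) \<in> borel_measurable (gauss n)"
  unfolding cov_def
  by (intro borel_measurable_diff borel_measurable_times borel_measurable_sum tilt_measurable) auto

lemma cov_bound: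
  assumes \<nu>: "\<And>y. 0 < \<nu> y" "sum \<nu> (cube n) = 1" and i: "i < n"
    and A: "\<And>y. y \<in> cube n \<Longrightarrow> \<bar>a y\<bar> \<le> A"
  shows "\<bar>cov n \<nu> a (\<lambda>y. y i)\<bar> \<le> 2 * A"
proof -
  have y1: "\<bar>y i\<bar> \<le> 1" if "y \<in> cube n" for y using cube_coord[OF that i] by auto
  have "\<bar>\<Sum>y\<in>cube n. \<nu> y * (a y * y i)\<bar> \<le> A"
  proof (rule abs_mean_le)
    show "\<bar>a y * y i\<bar> \<le> A" if "y \<in> cube n" for y
      using mult_mono[OF A[OF that] y1[OF that]] A[OF that] by (simp add: abs_mult)
  qed (use \<nu> in \<open>auto simp: less_imp_le\<close>)
  moreover have "\<bar>\<Sum>y\<in>cube n. \<nu> y * a y\<bar> \<le> A" "\<bar>\<Sum>y\<in>cube n. \<nu> y * y i\<bar> \<le> 1"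
    by (rule abs_mean_le; use \<nu> A y1 in \<open>auto simp: less_imp_le\<close>)+
  then have "\<bar>\<Sum>y\<in>cube n. \<nu> y * a y\<bar> * \<bar>\<Sum>y\<in>cube n. \<nu> y * y i\<bar> \<le> A * 1"
    by (intro mult_mono) auto
  ultimately show ?thesis unfolding cov_def by (simp add: abs_mult[symmetric])
qed

text \<open>The subtracted constant \<open>c\<close> does not affect the derivative; it is the
  prescribed mean \<open>m i\<close> in one later use and 0 in the other.\<close>

lemma gauss_tilt_by_parts:
  fixes r :: real
  assumes b: "\<And>y. 0 < b y" and i: "i < n"
  defines "\<nu> \<equiv> \<lambda>\<Gamma>. tilt n b (\<lambda>j. r * \<Gamma> j)"
  shows "integrable (gauss n) (\<lambda>\<Gamma>. \<Gamma> i * ((\<Sum>y\<in>cube n. \<nu> \<Gamma> y * a y) - c))"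
    and "integrable (gauss n) (\<lambda>\<Gamma>. cov n (\<nu> \<Gamma>) a (\<lambda>y. y i))"
    and "(\<integral>\<Gamma>. \<Gamma> i * ((\<Sum>y\<in>cube n. \<nu> \<Gamma> y * a y) - c) \<partial>gauss n)
           = r * (\<integral>\<Gamma>. cov n (\<nu> \<Gamma>) a (\<lambda>y. y i) \<partial>gauss n)"
proof -
  define A where "A = Max ((\<lambda>y. \<bar>a y\<bar>) ` cube n)"
  have A: "\<bar>a y\<bar> \<le> A" if "y \<in> cube n" for y unfolding A_def using that by (intro Max_ge) auto
  have pos: "0 < \<nu> \<Gamma> y" and sum1: "sum (\<nu> \<Gamma>) (cube n) = 1" for \<Gamma> y
    unfolding \<nu>_def by (intro tilt_pos sum_tilt b)+
  have m: "(\<lambda>\<Gamma>. (\<Sum>y\<in>cube n. \<nu> \<Gamma> y * a y) - c) \<in> borel_measurable (gauss n)"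
    unfolding \<nu>_def by (intro borel_measurable_diff borel_measurable_times borel_measurable_sum tilt_measurable) auto
  have m': "(\<lambda>\<Gamma>. cov n (\<nu> \<Gamma>) a (\<lambda>y. y i)) \<in> borel_measurable (gauss n)"
    unfolding \<nu>_def by (rule cov_tilt_measurable)
  have B: "\<bar>(\<Sum>y\<in>cube n. \<nu> \<Gamma> y * a y) - c\<bar> \<le> A + \<bar>c\<bar>" for \<Gamma>
  proof -
    have "\<bar>\<Sum>y\<in>cube n. \<nu> \<Gamma> y * a y\<bar> \<le> A"
      by (rule abs_mean_le) (use pos sum1 A in \<open>auto simp: less_imp_le\<close>)
    then show ?thesis by linarith
  qed
  have B': "\<bar>cov n (\<nu> \<Gamma>) a (\<lambda>y. y i)\<bar> \<le> 2 * A" for \<Gamma>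
    by (rule cov_bound[OF pos sum1 i A])
  show "integrable (gauss n) (\<lambda>\<Gamma>. \<Gamma> i * ((\<Sum>y\<in>cube n. \<nu> \<Gamma> y * a y) - c))"
    using i m B by (rule integrable_gauss_component_mult)
  show "integrable (gauss n) (\<lambda>\<Gamma>. cov n (\<nu> \<Gamma>) a (\<lambda>y. y i))"
    using m' B' by (rule integrable_gauss_bounded)
  have d: "((\<lambda>t. \<nu> (\<Gamma>(i := t)) y) has_real_derivative
      r * (y i - (\<Sum>z\<in>cube n. \<nu> (\<Gamma>(i := t)) z * z i)) * \<nu> (\<Gamma>(i := t)) y) (at t)" for \<Gamma> t y
    unfolding \<nu>_def by (rule tilt_has_derivative[OF b i])
  have cont: "continuous_on UNIV (\<lambda>t. \<nu> (\<Gamma>(i := t)) y)" for \<Gamma> y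
    using d by (meson DERIV_isCont continuous_at_imp_continuous_on)
  have "(\<integral>\<Gamma>. \<Gamma> i * ((\<Sum>y\<in>cube n. \<nu> \<Gamma> y * a y) - c) \<partial>gauss n)
      = (\<integral>\<Gamma>. r * cov n (\<nu> \<Gamma>) a (\<lambda>y. y i) \<partial>gauss n)"
  proof (rule gauss_integration_by_parts[OF i m B])
    show "(\<lambda>\<Gamma>. r * cov n (\<nu> \<Gamma>) a (\<lambda>y. y i)) \<in> borel_measurable (gauss n)" using m' by simp
    show "\<bar>r * cov n (\<nu> \<Gamma>) a (\<lambda>y. y i)\<bar> \<le> \<bar>r\<bar> * (2 * A)" for \<Gamma>
      unfolding abs_mult by (intro mult_left_mono B') auto
    show "((\<lambda>t. (\<Sum>y\<in>cube n. \<nu> (\<Gamma>(i := t)) y * a y) - c) has_real_derivative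
        r * cov n (\<nu> (\<Gamma>(i := t))) a (\<lambda>y. y i)) (at t)" for \<Gamma> t
      using DERIV_diff[OF tilt_mean_has_derivative[OF b i] DERIV_const] unfolding \<nu>_def by simp
    show "continuous_on UNIV (\<lambda>t. r * cov n (\<nu> (\<Gamma>(i := t))) a (\<lambda>y. y i))" for \<Gamma>
      unfolding cov_def by (intro continuous_intros cont)
  qed
  then show "(\<integral>\<Gamma>. \<Gamma> i * ((\<Sum>y\<in>cube n. \<nu> \<Gamma> y * a y) - c) \<partial>gauss n)
           = r * (\<integral>\<Gamma>. cov n (\<nu> \<Gamma>) a (\<lambda>y. y i) \<partial>gauss n)" by simp
qed

text \<open>With \<open>m\<close> the untilted mean, the first sum dominates the relative entropy of the tilted measure with
  respect to the untilted one. The tilt \<open>W = r \<Gamma>\<close> is chosen by averaging over \<open>\<Gamma>\<close>.\<close>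

lemma exists_tilt:
  assumes b: "\<And>y. 0 < b y" and r: "0 < r" and c: "0 < c"
  shows "\<exists>W. (\<Sum>i<n. W i * ((\<Sum>y\<in>cube n. tilt n b W y * y i) - m i))
      + (\<Sum>i<n. cov n (tilt n b W) (pd i g) (\<lambda>y. y i)) / c \<le> real n * r\<^sup>2 + DD n g / (c * r)"
proof -
  define \<nu> where "\<nu> \<Gamma> = tilt n b (\<lambda>j. r * \<Gamma> j)" for \<Gamma>
  interpret G: prob_space "gauss n" by (rule prob_space_gauss)
  have pos: "0 < \<nu> \<Gamma> y" and sum1: "sum (\<nu> \<Gamma>) (cube n) = 1" for \<Gamma> y
    unfolding \<nu>_def by (intro tilt_pos sum_tilt b)+
  note parts = gauss_tilt_by_parts[where b = b and r = r and n = n, folded \<nu>_def, OF b]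
  define X where "X \<Gamma> = (\<Sum>i<n. r * \<Gamma> i * ((\<Sum>y\<in>cube n. \<nu> \<Gamma> y * y i) - m i))" for \<Gamma>
  define Y where "Y \<Gamma> = (\<Sum>i<n. cov n (\<nu> \<Gamma>) (pd i g) (\<lambda>y. y i))" for \<Gamma>
  \<comment> \<open>The \<open>- 0\<close> gives the summands the shape of
    \<open>gauss_tilt_by_parts\<close> with constant 0.\<close>
  define T where "T \<Gamma> = (\<Sum>i<n. \<Gamma> i * ((\<Sum>y\<in>cube n. \<nu> \<Gamma> y * pd i g y) - 0))" for \<Gamma>
  define K where "K = grad n g ` cube n \<union> {\<lambda>_. 0}"
  have X: "integrable (gauss n) X"
    unfolding X_def[abs_def] mult.assoc
    by (intro Bochner_Integration.integrable_sum integrable_mult_right parts) simp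
  have Y: "integrable (gauss n) Y"
    unfolding Y_def[abs_def] by (intro Bochner_Integration.integrable_sum parts) simp
  have T: "integrable (gauss n) T"
    unfolding T_def[abs_def] by (intro Bochner_Integration.integrable_sum parts) simp
  have "integral\<^sup>L (gauss n) X = (\<Sum>i<n. \<integral>\<Gamma>. r * (\<Gamma> i * ((\<Sum>y\<in>cube n. \<nu> \<Gamma> y * y i) - m i)) \<partial>gauss n)"
    unfolding X_def[abs_def] mult.assoc
    by (intro Bochner_Integration.integral_sum integrable_mult_right parts) simp
  also have "\<dots> = (\<Sum>i<n. r * (r * (\<integral>\<Gamma>. cov n (\<nu> \<Gamma>) (\<lambda>y. y i) (\<lambda>y. y i) \<partial>gauss n)))"
    by (intro sum.cong refl) (simp add: parts(3))
  \<comment> \<open>The covariance of a coordinate with itself is the variance of a sign, at most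
    1.\<close>
  also have "\<dots> \<le> (\<Sum>i<n. r * (r * 1))"
  proof (intro sum_mono mult_left_mono)
    fix i assume i: "i \<in> {..<n}"
    have "(\<integral>\<Gamma>. cov n (\<nu> \<Gamma>) (\<lambda>y. y i) (\<lambda>y. y i) \<partial>gauss n) \<le> (\<integral>\<Gamma>. 1 \<partial>gauss n)"
    proof (rule integral_mono)
      fix \<Gamma>
      have "(\<Sum>y\<in>cube n. \<nu> \<Gamma> y * (y i * y i)) = sum (\<nu> \<Gamma>) (cube n)"
        using i by (intro sum.cong) (auto dest: cube_coord)
      then show "cov n (\<nu> \<Gamma>) (\<lambda>y. y i) (\<lambda>y. y i) \<le> 1"
        by (simp add: cov_def sum1)
    qed (use i parts in auto)
    then show "(\<integral>\<Gamma>. cov n (\<nu> \<Gamma>) (\<lambda>y. y i) (\<lambda>y. y i) \<partial>gauss n) \<le> 1"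
      by (simp add: G.prob_space)
  qed (use r in auto)
  finally have EX: "integral\<^sup>L (gauss n) X \<le> real n * r\<^sup>2" by (simp add: power2_eq_square)
  \<comment> \<open>Integration by parts in reverse: the covariances become the pairing of the
    Gaussian vector with the mean gradient, an average of points of \<open>K\<close>, so it is at
    most the supremum over \<open>K\<close>.\<close>
  have "r * integral\<^sup>L (gauss n) Y = (\<Sum>i<n. r * (\<integral>\<Gamma>. cov n (\<nu> \<Gamma>) (pd i g) (\<lambda>y. y i) \<partial>gauss n))"
    unfolding Y_def[abs_def] by (subst Bochner_Integration.integral_sum) (auto intro: parts simp: sum_distrib_left)
  also have "\<dots> = (\<Sum>i<n. \<integral>\<Gamma>. \<Gamma> i * ((\<Sum>y\<in>cube n. \<nu> \<Gamma> y * pd i g y) - 0) \<partial>gauss n)"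
    by (intro sum.cong refl parts(3)[symmetric]) simp
  also have "\<dots> = integral\<^sup>L (gauss n) T"
    unfolding T_def[abs_def] by (intro Bochner_Integration.integral_sum[symmetric] parts) simp
  also have "\<dots> \<le> DD n g"
    unfolding DD_def GW_def K_def[symmetric]
  proof (rule integral_mono[OF T])
    show "integrable (gauss n) (\<lambda>\<Gamma>. Sup ((\<lambda>x. \<Sum>i<n. x i * \<Gamma> i) ` K))"
      by (rule integrable_Sup_linear) (auto simp: K_def)
    fix \<Gamma> :: "nat \<Rightarrow> real"
    let ?S = "Sup ((\<lambda>x. \<Sum>i<n. x i * \<Gamma> i) ` K)"
    have "T \<Gamma> = (\<Sum>i<n. \<Sum>y\<in>cube n. \<nu> \<Gamma> y * (pd i g y * \<Gamma> i))"
      unfolding T_def by (auto simp: sum_distrib_left intro!: sum.cong)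
    also have "\<dots> = (\<Sum>y\<in>cube n. \<nu> \<Gamma> y * (\<Sum>i<n. grad n g y i * \<Gamma> i))"
      by (subst sum.swap) (auto simp: grad_def sum_distrib_left intro!: sum.cong)
    also have "\<dots> \<le> (\<Sum>y\<in>cube n. \<nu> \<Gamma> y * ?S)"
      by (intro sum_mono mult_left_mono Sup_linear_upper) (auto simp: K_def less_imp_le[OF pos])
    also have "\<dots> = ?S" by (simp add: sum_distrib_right[symmetric] sum1)
    finally show "T \<Gamma> \<le> ?S" .
  qed
  finally have EY: "integral\<^sup>L (gauss n) Y / c \<le> DD n g / (c * r)"
    using r c by (simp add: field_simps)
  have "\<exists>\<Gamma>. X \<Gamma> + Y \<Gamma> / c \<le> real n * r\<^sup>2 + DD n g / (c * r)"
  proof (rule ccontr)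
    assume "\<not> ?thesis"
    then have "real n * r\<^sup>2 + DD n g / (c * r) < X \<Gamma> + Y \<Gamma> / c" for \<Gamma> by (auto simp: not_le)
    then have "real n * r\<^sup>2 + DD n g / (c * r) < (\<integral>\<Gamma>. X \<Gamma> + Y \<Gamma> / c \<partial>gauss n)"
      using X Y by (intro G.expectation_greater) auto
    also have "\<dots> = integral\<^sup>L (gauss n) X + integral\<^sup>L (gauss n) Y / c" using X Y by simp
    finally show False using EX EY by linarith
  qed
  then obtain \<Gamma> where "X \<Gamma> + Y \<Gamma> / c \<le> real n * r\<^sup>2 + DD n g / (c * r)" by blast
  then show ?thesis unfolding X_def Y_def \<nu>_def by (rule exI[of _ "\<lambda>j. r * \<Gamma> j"])
qed

text \<open>Here \<open>r\<close> is the strength of the random tilt and \<open>c\<close> the free parameter of the transport inequality.\<close>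

lemma mean_field_approximation:
  assumes p: "0 < p" "p < 1" and r: "0 < r" and c: "0 < c"
    and g: "\<And>y i. y \<in> cube n \<Longrightarrow> i < n \<Longrightarrow> \<bar>pd i g y\<bar> \<le> l"
  shows "\<exists>q. (\<forall>i<n. 0 < q i \<and> q i < 1) \<and>
    ln (\<Sum>y\<in>cube n. pw n (\<lambda>_. p) y * exp (g y))
      \<le> (\<Sum>y\<in>cube n. pw n q y * g y) - KL n (pw n q) (pw n (\<lambda>_. p))
        + real n * r\<^sup>2 + DD n g / (c * r) + c * real n * l\<^sup>2 / 2"
proof -
  let ?b = "\<lambda>y. pw n (\<lambda>_. p) y * exp (g y)"
  have b: "0 < ?b y" for y using pw_pos[of n "\<lambda>_. p" y] p by simp
  obtain W where W: "(\<Sum>i<n. W i * ((\<Sum>y\<in>cube n. tilt n ?b W y * y i) - (\<Sum>y\<in>cube n. tilt n ?b (\<lambda>_. 0) y * y i)))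
      + (\<Sum>i<n. cov n (tilt n ?b W) (pd i g) (\<lambda>y. y i)) / c \<le> real n * r\<^sup>2 + DD n g / (c * r)"
    using exists_tilt[of ?b r c n "\<lambda>i. \<Sum>y\<in>cube n. tilt n ?b (\<lambda>_. 0) y * y i" g, OF b r c] by blast
  obtain q where "\<forall>i<n. 0 < q i \<and> q i < 1"
    and "ln (\<Sum>y\<in>cube n. ?b y)
      \<le> (\<Sum>y\<in>cube n. pw n q y * g y) - KL n (pw n q) (pw n (\<lambda>_. p))
        + (\<Sum>i<n. W i * ((\<Sum>y\<in>cube n. tilt n ?b W y * y i) - (\<Sum>y\<in>cube n. tilt n ?b (\<lambda>_. 0) y * y i)))
        + (\<Sum>i<n. cov n (tilt n ?b W) (pd i g) (\<lambda>y. y i)) / c + c * real n * l\<^sup>2 / 2"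
    using mean_field_step[where p = p and n = n and g = g and l = l and W = W, OF p c g] by blast
  with W show ?thesis by (intro exI[of _ q] conjI) (assumption, linarith)
qed

section \<open>A smooth concave cutoff\<close>

text \<open>For \<open>0 \<le> d\<close> this is the projection of -u onto [0, d], that is, the
  minimiser of z^2 + 2 z u over that interval.\<close>

definition clamp_neg :: "real \<Rightarrow> real \<Rightarrow> real" where
  "clamp_neg d u = min d (max 0 (- u))"

text \<open>The ramp vanishes on \<open>[0, \<infinity>)\<close>, equals \<open>- a u\<^sup>2\<close> on \<open>[-d, 0]\<close> and continues linearly with
  slope \<open>2 a d\<close> below \<open>-d\<close>. It is written as the minimum over \<open>z \<in> [0, d]\<close> of \<open>a (z\<^sup>2 + 2 z u)\<close>,
  from which concavity and the second order bound follow without case distinctions.\<close>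

definition ramp :: "real \<Rightarrow> real \<Rightarrow> real \<Rightarrow> real" where
  "ramp a d u = a * ((clamp_neg d u)\<^sup>2 + 2 * clamp_neg d u * u)"

lemma clamp_neg_bounds: "0 \<le> d \<Longrightarrow> 0 \<le> clamp_neg d u \<and> clamp_neg d u \<le> d"
  by (auto simp: clamp_neg_def)

text \<open>The first order optimality condition of the projection.\<close>

lemma clamp_neg_projection:
  assumes "0 \<le> z" "z \<le> d"
  shows "0 \<le> (z - clamp_neg d u) * (clamp_neg d u + u)"
proof -
  consider "0 \<le> u" | "u < 0" "- u \<le> d" | "d < - u" "u < 0" using assms by linarith
  then show ?thesis
    using assms by cases (auto simp: clamp_neg_def max_def min_def intro: mult_nonpos_nonpos)
qed

text \<open>The minimiser for \<open>u\<close> is a competitor in the minimum that defines the value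
  at \<open>v\<close>, which yields the tangent line at \<open>u\<close> as an upper bound.\<close>

lemma ramp_concave:
  assumes "0 \<le> a" "0 \<le> d"
  shows "ramp a d v \<le> ramp a d u + 2 * a * clamp_neg d u * (v - u)"
proof -
  let ?z = "clamp_neg d u" and ?w = "clamp_neg d v"
  have "0 \<le> (?z - ?w) * (?w + v)"
    using clamp_neg_projection clamp_neg_bounds[OF assms(2), of u] by blast
  then have "0 \<le> (?z - ?w)\<^sup>2 + 2 * ((?z - ?w) * (?w + v))" by simp
  then have "0 \<le> a * ((?z - ?w)\<^sup>2 + 2 * ((?z - ?w) * (?w + v)))" using assms by simp
  then show ?thesis by (simp add: ramp_def algebra_simps power2_eq_square)
qed

text \<open>The gap is \<open>a\<close> times the sum of twice the optimality expression at
  \<open>u\<close> and a perfect square.\<close>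

lemma ramp_second_order:
  assumes "0 \<le> a" "0 \<le> d"
  shows "ramp a d u + 2 * a * clamp_neg d u * (v - u) - a * (v - u)\<^sup>2 \<le> ramp a d v"
proof -
  let ?z = "clamp_neg d u" and ?w = "clamp_neg d v"
  have "0 \<le> (?w - ?z) * (?z + u)"
    using clamp_neg_projection clamp_neg_bounds[OF assms(2), of v] by blast
  then have "0 \<le> 2 * ((?w - ?z) * (?z + u)) + ((?z - ?w) - (v - u))\<^sup>2" by simp
  then have "0 \<le> a * (2 * ((?w - ?z) * (?z + u)) + ((?z - ?w) - (v - u))\<^sup>2)" using assms by simp
  then show ?thesis by (simp add: ramp_def algebra_simps power2_eq_square)
qed

lemma ramp_nonneg_arg: "0 \<le> u \<Longrightarrow> 0 \<le> d \<Longrightarrow> ramp a d u = 0"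
  by (auto simp: ramp_def clamp_neg_def)

lemma ramp_nonpos:
  assumes "0 \<le> a" "0 \<le> d"
  shows "ramp a d u \<le> 0"
  using ramp_concave[OF assms, of u 0] ramp_nonneg_arg[of 0 d a] assms by (simp add: clamp_neg_def)

lemma ramp_le: "0 \<le> a \<Longrightarrow> 0 \<le> d \<Longrightarrow> u \<le> - d \<Longrightarrow> ramp a d u \<le> - (a * d\<^sup>2)"
proof -
  assume a: "0 \<le> a" and d: "0 \<le> d" and u: "u \<le> - d"
  have "clamp_neg d u = d" using d u by (auto simp: clamp_neg_def)
  then have "ramp a d u = a * d\<^sup>2 + 2 * (a * d * u)" by (simp add: ramp_def algebra_simps)
  moreover have "a * d * u \<le> a * d * (- d)" using a d u by (intro mult_left_mono) auto
  ultimately show ?thesis by (simp add: power2_eq_square)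
qed

lemma ramp_lipschitz:
  assumes "0 \<le> a" "0 \<le> d"
  shows "\<bar>ramp a d v - ramp a d u\<bar> \<le> 2 * a * d * \<bar>v - u\<bar>"
proof -
  have "ramp a d v - ramp a d u \<le> 2 * a * d * \<bar>v - u\<bar>" for u v
  proof -
    have "ramp a d v - ramp a d u \<le> 2 * a * clamp_neg d u * (v - u)"
      using ramp_concave[OF assms, of v u] by simp
    also have "\<dots> \<le> 2 * a * clamp_neg d u * \<bar>v - u\<bar>"
      using clamp_neg_bounds[OF assms(2), of u] assms by (intro mult_left_mono) auto
    also have "\<dots> \<le> 2 * a * d * \<bar>v - u\<bar>"
      using clamp_neg_bounds[OF assms(2), of u] assms by (intro mult_left_mono mult_right_mono) auto
    finally show ?thesis .
  qed
  from this[of v u] this[of u v] show ?thesis by (auto simp: abs_minus_commute)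
qed

section \<open>Lipschitz constant and gradient width of the cutoff function\<close>

lemma finite_pd_set: "finite {\<bar>pd i g y\<bar> | i y. i < n \<and> y \<in> cube n}"
proof -
  have "{\<bar>pd i g y\<bar> | i y. i < n \<and> y \<in> cube n} = (\<lambda>(i, y). \<bar>pd i g y\<bar>) ` ({..<n} \<times> cube n)" by auto
  then show ?thesis by simp
qed

lemma abs_pd_le_Lip: "i < n \<Longrightarrow> y \<in> cube n \<Longrightarrow> \<bar>pd i g y\<bar> \<le> Lip n g"
  unfolding Lip_def using finite_pd_set[of g n] by (intro Max_ge) auto

lemma Lip_nonneg: "0 \<le> Lip n g"
  unfolding Lip_def using finite_pd_set[of g n] by (intro Max_ge) auto

text \<open>A chain rule with error. Along edge \<open>i\<close>, \<open>f\<close> changes by twice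
  \<open>pd i f y\<close> up to sign, so concavity and the second order bound leave an error of at
  most a (2 l)^2, halved by \<open>pd\<close>.\<close>

lemma pd_ramp:
  assumes "0 \<le> a" "0 \<le> d" and y: "y \<in> cube n" "i < n" and l: "\<bar>pd i f y\<bar> \<le> l"
  shows "\<bar>pd i (\<lambda>y. ramp a d (f y - s)) y - 2 * a * clamp_neg d (f y - s) * pd i f y\<bar> \<le> 2 * a * l\<^sup>2"
proof -
  let ?z = "clamp_neg d (f y - s)"
  let ?R = "\<lambda>y. ramp a d (f y - s)"
  have l2: "a * (2 * pd i f y)\<^sup>2 \<le> 4 * (a * l\<^sup>2)"
    using abs_le_square_iff[of "pd i f y" l] l assms(1) by (simp add: power_mult_distrib mult_left_mono)
  have up: "?R v \<le> ?R y + 2 * a * ?z * (f v - f y)"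
    and low: "?R y + 2 * a * ?z * (f v - f y) - a * (f v - f y)\<^sup>2 \<le> ?R v" for v
    using ramp_concave[OF assms(1,2), of "f v - s" "f y - s"]
      ramp_second_order[OF assms(1,2), of "f y - s" "f v - s"] by auto
  from cube_coord[OF y] show ?thesis
  proof
    assume "y i = 1"
    then have e: "y(i := 1) = y" by auto
    let ?v = "y(i := - 1)"
    have v: "f ?v - f y = - (2 * pd i f y)" unfolding pd_def e by (simp add: field_simps)
    have "pd i ?R y = (?R y - ?R ?v) / 2" unfolding pd_def e ..
    with up[of ?v] low[of ?v] l2 show ?thesis unfolding v by (simp add: abs_le_iff)
  next
    assume "y i = - 1"
    then have e: "y(i := - 1) = y" by auto
    let ?v = "y(i := 1)"
    have v: "f ?v - f y = 2 * pd i f y" unfolding pd_def e by simp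
    have "pd i ?R y = (?R ?v - ?R y) / 2" unfolding pd_def e ..
    with up[of ?v] low[of ?v] l2 show ?thesis unfolding v by (simp add: abs_le_iff)
  qed
qed

text \<open>By the chain rule each gradient of the cutoff is a multiple, in [0, 2 a d], of a
  gradient of \<open>f\<close>, plus an error of size 2 a l^2 per coordinate. The multiple may be
  raised to 2 a d because the supremum, taken over a set containing 0, is nonnegative.\<close>

lemma DD_ramp_le:
  assumes ad: "0 \<le> a" "0 \<le> d" and l: "\<And>y i. y \<in> cube n \<Longrightarrow> i < n \<Longrightarrow> \<bar>pd i f y\<bar> \<le> l"
  shows "DD n (\<lambda>y. ramp a d (f y - s)) \<le> 2 * a * d * DD n f + 2 * a * l\<^sup>2 * real n"
proof -
  define g where "g y = ramp a d (f y - s)" for y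
  let ?S = "\<lambda>g \<Gamma>. Sup ((\<lambda>x. \<Sum>i<n. x i * \<Gamma> i) ` (grad n g ` cube n \<union> {\<lambda>_. 0}))"
  have S: "integrable (gauss n) (?S g)" for g
    by (rule integrable_Sup_linear) auto
  have abs: "integrable (gauss n) (\<lambda>\<Gamma>. \<Sum>i<n. \<bar>\<Gamma> i\<bar>)"
    by (intro Bochner_Integration.integrable_sum integrable_gauss_component) simp
  have "DD n g = (\<integral>\<Gamma>. ?S g \<Gamma> \<partial>gauss n)" by (simp add: DD_def GW_def)
  also have "\<dots> \<le> (\<integral>\<Gamma>. 2 * a * d * ?S f \<Gamma> + 2 * a * l\<^sup>2 * (\<Sum>i<n. \<bar>\<Gamma> i\<bar>) \<partial>gauss n)"
  proof (rule integral_mono[OF S])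
    show "integrable (gauss n) (\<lambda>\<Gamma>. 2 * a * d * ?S f \<Gamma> + 2 * a * l\<^sup>2 * (\<Sum>i<n. \<bar>\<Gamma> i\<bar>))"
      using S abs by (intro Bochner_Integration.integrable_add integrable_mult_right)
    fix \<Gamma> :: "nat \<Rightarrow> real"
    have Sf0: "0 \<le> ?S f \<Gamma>"
      using Sup_linear_upper[where K = "grad n f ` cube n \<union> {\<lambda>_. 0}" and x = "\<lambda>_. 0" and \<Gamma> = \<Gamma>] by simp
    have a2: "0 \<le> 2 * a * l\<^sup>2 * (\<Sum>i<n. \<bar>\<Gamma> i\<bar>)" "0 \<le> 2 * a * d * ?S f \<Gamma>"
      using ad Sf0 by (auto intro!: mult_nonneg_nonneg sum_nonneg)
    show "?S g \<Gamma> \<le> 2 * a * d * ?S f \<Gamma> + 2 * a * l\<^sup>2 * (\<Sum>i<n. \<bar>\<Gamma> i\<bar>)"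
    proof (rule cSup_least)
      fix w assume "w \<in> (\<lambda>x. \<Sum>i<n. x i * \<Gamma> i) ` (grad n g ` cube n \<union> {\<lambda>_. 0})"
      then consider "w = 0" | y where "y \<in> cube n" "w = (\<Sum>i<n. grad n g y i * \<Gamma> i)" by auto
      then show "w \<le> 2 * a * d * ?S f \<Gamma> + 2 * a * l\<^sup>2 * (\<Sum>i<n. \<bar>\<Gamma> i\<bar>)"
      proof cases
        case 1
        then show ?thesis using a2 by linarith
      next
        case 2
        let ?c = "2 * a * clamp_neg d (f y - s)"
        have c: "0 \<le> ?c" "?c \<le> 2 * a * d"
          using clamp_neg_bounds[OF ad(2), of "f y - s"] ad(1) by (auto intro: mult_left_mono)
        have "w = (\<Sum>i<n. pd i g y * \<Gamma> i)" using 2 by (simp add: grad_def)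
        also have "\<dots> \<le> (\<Sum>i<n. ?c * (pd i f y * \<Gamma> i) + 2 * a * l\<^sup>2 * \<bar>\<Gamma> i\<bar>)"
        proof (rule sum_mono)
          fix i assume "i \<in> {..<n}"
          then have "\<bar>pd i g y - ?c * pd i f y\<bar> \<le> 2 * a * l\<^sup>2"
            unfolding g_def using 2 by (intro pd_ramp ad l) auto
          then have "\<bar>pd i g y - ?c * pd i f y\<bar> * \<bar>\<Gamma> i\<bar> \<le> 2 * a * l\<^sup>2 * \<bar>\<Gamma> i\<bar>"
            by (intro mult_right_mono) auto
          then have "(pd i g y - ?c * pd i f y) * \<Gamma> i \<le> 2 * a * l\<^sup>2 * \<bar>\<Gamma> i\<bar>"
            unfolding abs_mult[symmetric] by linarith
          then show "pd i g y * \<Gamma> i \<le> ?c * (pd i f y * \<Gamma> i) + 2 * a * l\<^sup>2 * \<bar>\<Gamma> i\<bar>"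
            by (simp add: algebra_simps)
        qed
        also have "\<dots> = ?c * (\<Sum>i<n. grad n f y i * \<Gamma> i) + 2 * a * l\<^sup>2 * (\<Sum>i<n. \<bar>\<Gamma> i\<bar>)"
          by (simp add: sum.distrib sum_distrib_left grad_def)
        also have "?c * (\<Sum>i<n. grad n f y i * \<Gamma> i) \<le> ?c * ?S f \<Gamma>"
          using 2 c(1) by (intro mult_left_mono Sup_linear_upper) auto
        also have "?c * ?S f \<Gamma> \<le> 2 * a * d * ?S f \<Gamma>" using c(2) Sf0 by (rule mult_right_mono)
        finally show ?thesis by simp
      qed
    qed auto
  qed
  also have "\<dots> = 2 * a * d * DD n f + 2 * a * l\<^sup>2 * (\<Sum>i<n. \<integral>\<Gamma>. \<bar>\<Gamma> i\<bar> \<partial>gauss n)"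
    using S abs by (simp add: DD_def GW_def Bochner_Integration.integral_sum integrable_gauss_component)
  also have "\<dots> \<le> 2 * a * d * DD n f + 2 * a * l\<^sup>2 * (\<Sum>i<n. 1)"
    using ad by (intro add_left_mono mult_left_mono sum_mono gauss_abs_moment_le) auto
  finally show ?thesis by (simp add: g_def[abs_def])
qed

section \<open>The rate function and the tail bounds\<close>

lemma KL_cong: "(\<And>y. y \<in> cube n \<Longrightarrow> \<nu> y = \<nu>' y) \<Longrightarrow> KL n \<nu> \<xi> = KL n \<nu>' \<xi>"
  unfolding KL_def by (intro sum.cong) auto

lemma phi_le:
  assumes "\<And>i. i < n \<Longrightarrow> 0 \<le> q i \<and> q i \<le> 1" and "t * real n \<le> (\<Sum>y\<in>cube n. pw n q y * f y)"
  shows "phi n p f t \<le> ereal (KL n (pw n q) (pw n (\<lambda>_. p)))"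
proof -
  have "product_pm n (pw n q)"
    unfolding product_pm_def pw_def using assms(1) by (intro exI[of _ q]) simp
  then show ?thesis
    unfolding phi_def KL_mu_p[symmetric]
    using assms(2) by (intro Inf_lower) (auto simp: mult.commute)
qed

lemma phi_geI:
  assumes "\<And>q. (\<And>i. i < n \<Longrightarrow> 0 \<le> q i \<and> q i \<le> 1) \<Longrightarrow> t * real n \<le> (\<Sum>y\<in>cube n. pw n q y * f y)
      \<Longrightarrow> x \<le> ereal (KL n (pw n q) (pw n (\<lambda>_. p)))"
  shows "x \<le> phi n p f t"
  unfolding phi_def
proof (rule Inf_greatest)
  fix z assume "z \<in> {ereal (KL n \<xi> (mu_p n p)) | \<xi>. product_pm n \<xi> \<and> t * real n \<le> (\<Sum>y\<in>cube n. f y * \<xi> y)}"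
  then obtain \<xi> q where z: "z = ereal (KL n \<xi> (mu_p n p))" and f: "t * real n \<le> (\<Sum>y\<in>cube n. f y * \<xi> y)"
    and q: "\<forall>i<n. 0 \<le> q i \<and> q i \<le> 1" and \<xi>: "\<And>y. y \<in> cube n \<Longrightarrow> \<xi> y = pw n q y"
    unfolding product_pm_def pw_def by blast
  have "x \<le> ereal (KL n (pw n q) (pw n (\<lambda>_. p)))"
    by (rule assms) (use q f \<xi> in \<open>auto simp: mult.commute\<close>)
  then show "x \<le> z" unfolding z KL_mu_p using KL_cong[OF \<xi>] by simp
qed

text \<open>A point mass is a product measure, with all marginal probabilities 0 or 1. It serves as
  a test measure for the rate function.\<close>

lemma pw_dirac:
  assumes "y \<in> cube n" "z \<in> cube n"
  shows "pw n (\<lambda>i. (1 + y i) / 2) z = (if z = y then 1 else 0)"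
proof (cases "z = y")
  case True
  have "pw n (\<lambda>i. (1 + y i) / 2) y = (\<Prod>i<n. 1)"
    unfolding pw_def
  proof (rule prod.cong)
    fix i assume "i \<in> {..<n}"
    then show "(if y i = 1 then (1 + y i) / 2 else 1 - (1 + y i) / 2) = 1"
      using cube_coord[OF assms(1), of i] by auto
  qed simp
  with True show ?thesis by simp
next
  case False
  then obtain i where i: "i < n" "z i \<noteq> y i"
    using assms unfolding cube_def by (metis PiE_ext lessThan_iff)
  then show ?thesis
    using False cube_coord[OF assms(1) i(1)] cube_coord[OF assms(2) i(1)]
    by (auto simp: pw_def intro!: prod_zero bexI[of _ i])
qed

lemma phi_le_dirac:
  assumes y: "y \<in> cube n" and f: "t * real n \<le> f y" and p: "0 < p" "p < 1"
  shows "phi n p f t \<le> ereal (- ln (pw n (\<lambda>_. p) y))"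
proof -
  let ?q = "\<lambda>i. (1 + y i) / 2"
  have w: "0 < pw n (\<lambda>_. p) y" using p by (intro pw_pos) auto
  have pick: "(\<Sum>z\<in>cube n. if z = y then F z else 0) = F y" for F :: "_ \<Rightarrow> real"
    using y by (simp add: sum.delta)
  have "(\<Sum>z\<in>cube n. pw n ?q z * f z) = (\<Sum>z\<in>cube n. if z = y then f z else 0)"
    by (intro sum.cong) (auto simp: pw_dirac[OF y])
  moreover have "KL n (pw n ?q) (pw n (\<lambda>_. p)) = (\<Sum>z\<in>cube n. if z = y then - ln (pw n (\<lambda>_. p) z) else 0)"
    unfolding KL_def using p by (intro sum.cong) (auto simp: pw_dirac[OF y] ln_div pw_pos[THEN less_imp_neq, symmetric] w)
  moreover have "0 \<le> ?q i \<and> ?q i \<le> 1" if "i < n" for i using cube_coord[OF y that] by auto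
  ultimately show ?thesis using phi_le[of n ?q t f p] f unfolding pick by metis
qed

lemma phi_nonneg:
  assumes p: "0 < p" "p < 1"
  shows "0 \<le> phi n p f t"
proof (rule phi_geI)
  fix q :: "nat \<Rightarrow> real" assume "\<And>i. i < n \<Longrightarrow> 0 \<le> q i \<and> q i \<le> 1"
  then have "0 \<le> KL n (pw n q) (pw n (\<lambda>_. p))"
    using p by (intro KL_nonneg sum_pw pw_nonneg pw_pos) auto
  then show "0 \<le> ereal (KL n (pw n q) (pw n (\<lambda>_. p)))" by simp
qed

text \<open>The mean-field bound is applied to a cutoff of \<open>f\<close> that vanishes on the
  event. Its slope is at most \<open>2 * k\<close>, and \<open>2 * k * B\<close> dominates its
  gradient width.\<close>

lemma upper_tail_parametric:
  fixes f :: "(nat \<Rightarrow> real) \<Rightarrow> real"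
  assumes n: "n \<ge> 1" and p: "0 < p" "p < 1" and \<delta>: "0 < \<delta>" and \<Phi>: "0 < \<Phi>"
    and phi: "phi n p f (t - \<delta>) = ereal \<Phi>"
    and pos: "0 < (\<Sum>y | y \<in> cube n \<and> t * real n \<le> f y. pw n (\<lambda>_. p) y)"
    and r: "0 < r" and c: "0 < c"
  defines "k \<equiv> \<Phi> / (real n * \<delta>)" and "B \<equiv> 2 * DD n f + 1 / \<delta> * (Lip n f)\<^sup>2"
  shows "ln (\<Sum>y | y \<in> cube n \<and> t * real n \<le> f y. pw n (\<lambda>_. p) y)
    \<le> - \<Phi> + real n * r\<^sup>2 + 2 * k * B / (c * r) + c * real n * (2 * k * Lip n f)\<^sup>2 / 2"
proof -
  define d where "d = \<delta> * real n"
  \<comment> \<open>Chosen so that a d^2 = \<Phi>: the cutoff has reached -\<Phi> once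
    \<open>f\<close> is \<open>d\<close> below the threshold.\<close>
  define a where "a = \<Phi> / (d * d)"
  define g where "g y = ramp a d (f y - t * real n)" for y
  let ?A = "{y. y \<in> cube n \<and> t * real n \<le> f y}"
  have d: "0 < d" using n \<delta> by (simp add: d_def)
  have a: "0 < a" using \<Phi> d by (simp add: a_def)
  have ad: "2 * a * d = 2 * k" using d by (simp add: a_def k_def d_def mult.commute)
  have w: "0 < pw n (\<lambda>_. p) y" for y using p by (intro pw_pos) auto
  have gp: "\<bar>pd i g y\<bar> \<le> 2 * k * Lip n f" if y: "y \<in> cube n" "i < n" for y i
  proof -
    have "\<bar>g (y(i := 1)) - g (y(i := - 1))\<bar> \<le> 2 * a * d * \<bar>f (y(i := 1)) - f (y(i := - 1))\<bar>"
      unfolding g_def using ramp_lipschitz[of a d "f (y(i := 1)) - t * real n" "f (y(i := - 1)) - t * real n"] a d by simp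
    then have "\<bar>pd i g y\<bar> \<le> 2 * a * d * \<bar>pd i f y\<bar>" unfolding pd_def by simp
    also have "\<dots> \<le> 2 * a * d * Lip n f"
      using abs_pd_le_Lip[OF y(2,1)] a d by (intro mult_left_mono) auto
    finally show ?thesis by (simp add: ad)
  qed
  obtain q where q: "\<forall>i<n. 0 < q i \<and> q i < 1"
    and mf: "ln (\<Sum>y\<in>cube n. pw n (\<lambda>_. p) y * exp (g y))
      \<le> (\<Sum>y\<in>cube n. pw n q y * g y) - KL n (pw n q) (pw n (\<lambda>_. p))
        + real n * r\<^sup>2 + DD n g / (c * r) + c * real n * (2 * k * Lip n f)\<^sup>2 / 2"
    using mean_field_approximation[where n = n, OF p r c gp] by blast
  have D: "DD n g \<le> 2 * k * B"
  proof -
    have "DD n g \<le> 2 * a * d * DD n f + 2 * a * (Lip n f)\<^sup>2 * real n"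
      unfolding g_def by (rule DD_ramp_le) (use a d abs_pd_le_Lip in auto)
    also have "2 * a * (Lip n f)\<^sup>2 * real n = 2 * k * (1 / \<delta> * (Lip n f)\<^sup>2)"
      using n \<delta> by (simp add: a_def d_def k_def mult_ac)
    also have "2 * a * d * DD n f + 2 * k * (1 / \<delta> * (Lip n f)\<^sup>2) \<le> 2 * k * B"
    proof -
      have "0 \<le> k" using n \<delta> \<Phi> by (simp add: k_def)
      then have "0 \<le> 2 * k * DD n f" using DD_nonneg[of n f] by simp
      then show ?thesis unfolding ad B_def by (simp add: algebra_simps)
    qed
    finally show ?thesis .
  qed
  have mean: "(\<Sum>y\<in>cube n. pw n q y * g y) - KL n (pw n q) (pw n (\<lambda>_. p)) \<le> - \<Phi>"
  proof -
    define m where "m = (\<Sum>y\<in>cube n. pw n q y * f y) - t * real n"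
    have wq: "0 \<le> pw n q y" for y using q by (intro pw_nonneg) (auto simp: less_imp_le)
    show ?thesis
    \<comment> \<open>Either \<open>q\<close> is admissible for the rate function, so the relative
      entropy is at least \<open>\<Phi>\<close>, or the mean of \<open>f\<close> lies
      \<open>d\<close> below the threshold and the cutoff supplies -\<Phi>.\<close>
    proof (cases "(t - \<delta>) * real n \<le> (\<Sum>y\<in>cube n. pw n q y * f y)")
      case True
      have "phi n p f (t - \<delta>) \<le> ereal (KL n (pw n q) (pw n (\<lambda>_. p)))"
        by (rule phi_le) (use q True in \<open>auto simp: less_imp_le\<close>)
      then have "\<Phi> \<le> KL n (pw n q) (pw n (\<lambda>_. p))" by (simp add: phi)
      moreover have "(\<Sum>y\<in>cube n. pw n q y * g y) \<le> 0"
        unfolding g_def using wq ramp_nonpos[of a d] a d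
        by (intro sum_nonpos mult_nonneg_nonpos) auto
      ultimately show ?thesis by linarith
    next
      case False
      then have "m \<le> - d" by (simp add: m_def d_def algebra_simps)
      \<comment> \<open>Jensen's inequality via the tangent line at the mean \<open>m\<close>, whose
        linear term averages to zero.\<close>
      have "(\<Sum>y\<in>cube n. pw n q y * g y)
          \<le> (\<Sum>y\<in>cube n. pw n q y * (ramp a d m + 2 * a * clamp_neg d m * (f y - t * real n - m)))"
        unfolding g_def using a d wq by (intro sum_mono mult_left_mono ramp_concave) auto
      also have "\<dots> = (ramp a d m - 2 * a * clamp_neg d m * (t * real n + m)) * (\<Sum>y\<in>cube n. pw n q y)
          + 2 * a * clamp_neg d m * (\<Sum>y\<in>cube n. pw n q y * f y)"
        unfolding sum_distrib_left sum.distrib[symmetric]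
        by (intro sum.cong) (auto simp: algebra_simps)
      also have "\<dots> = ramp a d m" by (simp add: sum_pw m_def algebra_simps)
      also have "\<dots> \<le> - (a * d\<^sup>2)" using a d \<open>m \<le> - d\<close> by (intro ramp_le) auto
      also have "\<dots> = - \<Phi>" using d by (simp add: a_def power2_eq_square)
      finally have "(\<Sum>y\<in>cube n. pw n q y * g y) \<le> - \<Phi>" .
      moreover have "0 \<le> KL n (pw n q) (pw n (\<lambda>_. p))"
        by (rule KL_nonneg) (use wq w in \<open>auto simp: sum_pw\<close>)
      ultimately show ?thesis by linarith
    qed
  qed
  have "(\<Sum>y\<in>?A. pw n (\<lambda>_. p) y) = (\<Sum>y\<in>?A. pw n (\<lambda>_. p) y * exp (g y))"
    using d by (intro sum.cong) (auto simp: g_def ramp_nonneg_arg)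
  also have "\<dots> \<le> (\<Sum>y\<in>cube n. pw n (\<lambda>_. p) y * exp (g y))"
    using w by (intro sum_mono2) (auto simp: less_imp_le)
  finally have "ln (\<Sum>y\<in>?A. pw n (\<lambda>_. p) y) \<le> ln (\<Sum>y\<in>cube n. pw n (\<lambda>_. p) y * exp (g y))"
    using pos by simp
  moreover have "DD n g / (c * r) \<le> 2 * k * B / (c * r)"
    using D r c by (intro divide_right_mono) auto
  ultimately show ?thesis using mf mean by linarith
qed

text \<open>Testing with point masses shows that each point of the event has mass at most
  exp(-\<Phi>), and there are at most 2^n <= exp n points.\<close>

lemma upper_tail_trivial:
  assumes p: "0 < p" "p < 1" and phi: "ereal \<Phi> \<le> phi n p f t"
    and pos: "0 < (\<Sum>y | y \<in> cube n \<and> t * real n \<le> f y. pw n (\<lambda>_. p) y)"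
  shows "ln (\<Sum>y | y \<in> cube n \<and> t * real n \<le> f y. pw n (\<lambda>_. p) y) \<le> - \<Phi> + real n"
proof -
  let ?A = "{y. y \<in> cube n \<and> t * real n \<le> f y}"
  have w: "0 < pw n (\<lambda>_. p) y" for y using p by (intro pw_pos) auto
  have "(\<Sum>y\<in>?A. pw n (\<lambda>_. p) y) \<le> (\<Sum>y\<in>?A. exp (- \<Phi>))"
  proof (rule sum_mono)
    fix y assume "y \<in> ?A"
    then have "ereal \<Phi> \<le> ereal (- ln (pw n (\<lambda>_. p) y))"
      using order_trans[OF phi phi_le_dirac[of y n t f p]] p by blast
    then show "pw n (\<lambda>_. p) y \<le> exp (- \<Phi>)"
      using w[of y] by (metis ereal_less_eq(3) exp_le_cancel_iff exp_ln le_minus_iff)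
  qed
  also have "\<dots> \<le> (\<Sum>y\<in>cube n. exp (- \<Phi>))" by (intro sum_mono2) auto
  also have "\<dots> = 2 ^ n * exp (- \<Phi>)" by (simp add: card_cube)
  also have "\<dots> \<le> exp (real n) * exp (- \<Phi>)"
  proof (intro mult_right_mono)
    have "2 \<le> exp (1 :: real)" using exp_ge_add_one_self[of 1] by simp
    then have "2 ^ n \<le> exp (1 :: real) ^ n" by (intro power_mono) auto
    then show "2 ^ n \<le> exp (real n)" by (simp add: exp_of_nat_mult[symmetric])
  qed simp
  also have "\<dots> = exp (- \<Phi> + real n)" by (simp add: exp_add[symmetric])
  finally show ?thesis using pos by (rule ln_le_of_le_exp[rotated])
qed

text \<open>In the present notation the permitted error is 64 n k X. If k X >= 1, the counting bound
  with error \<open>n\<close> suffices; otherwise \<open>r\<close> and \<open>c\<close> are chosen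
  to balance the parametric bound.\<close>

lemma upper_tail:
  fixes f :: "(nat \<Rightarrow> real) \<Rightarrow> real"
  assumes n: "n \<ge> 1" and p: "0 < p" "p < 1" and \<delta>: "0 < \<delta>" and \<Phi>: "0 < \<Phi>"
    and phi: "phi n p f (t - \<delta>) = ereal \<Phi>"
    and pos: "0 < (\<Sum>y | y \<in> cube n \<and> t * real n \<le> f y. pw n (\<lambda>_. p) y)"
  defines "L \<equiv> (1 / \<delta>) * (2 * Lip n f + \<bar>ln (p * (1 - p))\<bar>) powr (2/3)
                 * (2 * DD n f + (1 / \<delta>) * (Lip n f)\<^sup>2) powr (1/3)"
  shows "ln (\<Sum>y | y \<in> cube n \<and> t * real n \<le> f y. pw n (\<lambda>_. p) y)
    \<le> - \<Phi> * (1 - 64 * L * real n powr (-1/3))"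
proof -
  define P where "P = (\<Sum>y | y \<in> cube n \<and> t * real n \<le> f y. pw n (\<lambda>_. p) y)"
  define k where "k = \<Phi> / (real n * \<delta>)"
  define B where "B = 2 * DD n f + 1 / \<delta> * (Lip n f)\<^sup>2"
  define M where "M = 2 * Lip n f + \<bar>ln (p * (1 - p))\<bar>"
  define X where "X = M powr (2/3) * B powr (1/3) * real n powr (-1/3)"
  have k: "0 < k" using n \<delta> \<Phi> by (simp add: k_def)
  have B: "0 \<le> B" using DD_nonneg[of n f] \<delta> by (simp add: B_def)
  have M: "0 < M"
  proof -
    have "p * (1 - p) < 1 * 1" using p by (intro mult_strict_mono) auto
    then have "ln (p * (1 - p)) < 0" using p by (subst ln_less_zero_iff) auto
    then show ?thesis using Lip_nonneg[of n f] by (simp add: M_def)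
  qed
  have lipM: "(2 * k * Lip n f)\<^sup>2 \<le> (k * M)\<^sup>2"
    using k Lip_nonneg[of n f] by (intro power_mono) (auto simp: M_def algebra_simps)
  have X: "0 \<le> X" by (simp add: X_def)
  have goal_eq: "- \<Phi> * (1 - 64 * L * real n powr (-1/3)) = - \<Phi> + 64 * real n * (k * X)"
    using n \<delta> by (simp add: L_def X_def k_def M_def B_def field_simps)
  have aux: "ln P \<le> - \<Phi> + real n * r\<^sup>2 + 2 * k * B / (c * r) + c * real n * (k * M)\<^sup>2 / 2"
    if "0 < r" "0 < c" for r c
  proof -
    have "c * real n * (2 * k * Lip n f)\<^sup>2 / 2 \<le> c * real n * (k * M)\<^sup>2 / 2"
      using lipM that by (intro divide_right_mono mult_left_mono) auto
    then show ?thesis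
      using upper_tail_parametric[OF n p \<delta> \<Phi> phi pos that] unfolding P_def k_def B_def by linarith
  qed
  have "ln P \<le> - \<Phi> + 64 * real n * (k * X)"
  proof (cases "1 \<le> k * X")
    case True
    have "ereal \<Phi> \<le> phi n p f t"
      unfolding phi[symmetric]
    proof (rule phi_geI)
      fix q assume q: "\<And>i. i < n \<Longrightarrow> 0 \<le> q i \<and> q i \<le> 1" and "t * real n \<le> (\<Sum>y\<in>cube n. pw n q y * f y)"
      moreover have "(t - \<delta>) * real n \<le> t * real n" using \<delta> by (intro mult_right_mono) auto
      ultimately show "phi n p f (t - \<delta>) \<le> ereal (KL n (pw n q) (pw n (\<lambda>_. p)))"
        by (intro phi_le) auto
    qed
    then have "ln P \<le> - \<Phi> + real n * 1" using upper_tail_trivial[OF p _ pos] by (simp add: P_def)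
    also have "real n * 1 \<le> real n * (64 * (k * X))" using True by (intro mult_left_mono) auto
    finally show ?thesis by (simp add: mult_ac)
  next
    case False
    show ?thesis
    \<comment> \<open>For B = 0 also X = 0, so the balanced parameters would degenerate. They are
      instead sent to zero, each of the two remaining errors being e / 2.\<close>
    proof (cases "B = 0")
      case True
      show ?thesis
      proof (rule field_le_epsilon)
        fix e :: real assume e: "0 < e"
        define r where "r = sqrt (e / (2 * real n))"
        define c where "c = e / (real n * (k * M)\<^sup>2)"
        have "0 < r" "0 < c" using e n k M by (auto simp: r_def c_def)
        from aux[OF this] have "ln P \<le> - \<Phi> + real n * r\<^sup>2 + c * real n * (k * M)\<^sup>2 / 2" by (simp add: True)
        moreover have "real n * r\<^sup>2 = e / 2" using e n by (simp add: r_def)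
        moreover have "c * real n * (k * M)\<^sup>2 = e" using n k M by (simp add: c_def)
        ultimately have "ln P \<le> - \<Phi> + e" by simp
        also have "\<dots> \<le> - \<Phi> + 64 * real n * (k * X) + e" using k X by simp
        finally show "ln P \<le> - \<Phi> + 64 * real n * (k * X) + e" .
      qed
    next
      case False
      then have B0: "0 < B" using B by simp
      then have X0: "0 < X" using M n by (simp add: X_def)
      have "X ^ 3 = M\<^sup>2 * B / real n"
      proof -
        have "(M powr (2/3)) ^ 3 = M\<^sup>2" "(B powr (1/3)) ^ 3 = B"
          using M B0 by (simp_all add: powr_power)
        moreover have "(real n powr (-1/3)) ^ 3 = 1 / real n"
          using n by (subst powr_power) (simp_all add: powr_minus_divide)
        ultimately show ?thesis by (simp add: X_def power_mult_distrib)
      qed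
      then have X3: "M\<^sup>2 * B = real n * X ^ 3" using n by simp
      define x where "x = k * X"
      have x: "0 < x" "x < 1" using k X0 \<open>\<not> 1 \<le> k * X\<close> by (auto simp: x_def)
      \<comment> \<open>With r = x = k X and M^2 B = n X^3, the three errors are n x^2, 2 n x and n
        x / 2, together at most 4 n x because x < 1.\<close>
      define c where "c = X / (k * M\<^sup>2)"
      have c: "0 < c" using X0 k M by (simp add: c_def)
      have "ln P \<le> - \<Phi> + real n * x\<^sup>2 + 2 * k * B / (c * x) + c * real n * (k * M)\<^sup>2 / 2"
        by (rule aux[OF x(1) c])
      moreover have "2 * k * B / (c * x) = 2 * real n * x"
      proof -
        have "2 * k * B / (c * x) = 2 * k * (M\<^sup>2 * B) / (X * X)"
          using k M X0 by (simp add: c_def x_def field_simps)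
        also have "\<dots> = 2 * real n * x" using X0 by (simp add: X3 x_def power3_eq_cube)
        finally show ?thesis .
      qed
      moreover have "c * real n * (k * M)\<^sup>2 = real n * x"
        using k M by (simp add: c_def x_def power2_eq_square)
      moreover have "real n * x\<^sup>2 \<le> real n * x"
        using x by (intro mult_left_mono) (auto simp: power2_eq_square)
      moreover have "0 \<le> real n * x" using x by simp
      ultimately have "ln P \<le> - \<Phi> + 4 * (real n * x)" by linarith
      also have "\<dots> \<le> - \<Phi> + 64 * (real n * x)" using x by simp
      finally show ?thesis by (simp add: x_def mult_ac)
    qed
  qed
  then show ?thesis unfolding goal_eq P_def .
qed

text \<open>Concentration gives the event mass at least 1 - s under \<open>q\<close>. The Gibbs
  principle for a multiple of its indicator then bounds its mass under the reference measure, using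
  1 <= (1 - s) (1 + 2 s) for 0 <= s <= 1/2.\<close>

lemma lower_tail:
  fixes f :: "(nat \<Rightarrow> real) \<Rightarrow> real"
  assumes n: "n \<ge> 1" and p: "0 < p" "p < 1" and \<delta>: "0 < \<delta>"
    and q: "\<And>i. i < n \<Longrightarrow> 0 \<le> q i \<and> q i \<le> 1"
    and mean: "t * real n \<le> (\<Sum>y\<in>cube n. pw n q y * f y)"
  defines "s \<equiv> (Lip n f)\<^sup>2 / (real n * \<delta>\<^sup>2)"
  assumes s: "s \<le> 1 / 2"
  defines "P \<equiv> \<Sum>y | y \<in> cube n \<and> (t - \<delta>) * real n \<le> f y. pw n (\<lambda>_. p) y"
  shows "0 < P" and "- KL n (pw n q) (pw n (\<lambda>_. p)) * (1 + 2 * s) - 2 \<le> ln P"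
proof -
  let ?KL = "KL n (pw n q) (pw n (\<lambda>_. p))"
  define A where "A = {y. y \<in> cube n \<and> (t - \<delta>) * real n \<le> f y}"
  define m where "m = (\<Sum>y\<in>cube n. pw n q y * f y)"
  define Q where "Q = sum (pw n q) A"
  have A: "A \<subseteq> cube n" by (auto simp: A_def)
  have finA: "finite A" using A by (rule finite_subset) simp
  have wq: "0 \<le> pw n q y" for y using q by (rule pw_nonneg)
  have w: "0 < pw n (\<lambda>_. p) y" for y using p by (intro pw_pos) auto
  have s0: "0 \<le> s" by (simp add: s_def)
  \<comment> \<open>A positive \<open>\<rho>\<close> in place of \<open>s\<close> keeps the division
    meaningful when \<open>s = 0\<close>; the limit is taken afterwards.\<close>
  have tail: "1 - Q \<le> \<rho>" if \<rho>: "0 < \<rho>" "s \<le> \<rho>" for \<rho>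
  proof -
    \<comment> \<open>The optimal Chernoff parameter when the squared Lipschitz constant equals
      \<rho> n \<delta>^2; the resulting exponent is -1 / (2 \<rho>).\<close>
    define z where "z = 1 / (\<rho> * real n * \<delta>)"
    have z: "0 < z" using \<rho> n \<delta> by (simp add: z_def)
    have "1 - Q = (\<Sum>y\<in>cube n - A. pw n q y)"
      using sum.subset_diff[OF A, of "pw n q"] by (simp add: sum_pw Q_def)
    also have "\<dots> \<le> (\<Sum>y\<in>cube n - A. pw n q y * exp (z * (m - \<delta> * real n) + - z * f y))"
    proof (rule sum_mono)
      fix y assume "y \<in> cube n - A"
      then have "f y \<le> (t - \<delta>) * real n" by (auto simp: A_def)
      also have "\<dots> \<le> m - \<delta> * real n" using mean by (simp add: m_def left_diff_distrib)
      finally have "0 \<le> z * (m - \<delta> * real n - f y)" using z by simp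
      then have "1 \<le> exp (z * (m - \<delta> * real n) + - z * f y)" by (simp add: algebra_simps)
      then have "pw n q y * 1 \<le> pw n q y * exp (z * (m - \<delta> * real n) + - z * f y)"
        using wq by (rule mult_left_mono)
      then show "pw n q y \<le> pw n q y * exp (z * (m - \<delta> * real n) + - z * f y)" by simp
    qed
    also have "\<dots> \<le> (\<Sum>y\<in>cube n. pw n q y * exp (z * (m - \<delta> * real n) + - z * f y))"
      using wq by (intro sum_mono2) auto
    also have "\<dots> = exp (z * (m - \<delta> * real n)) * (\<Sum>y\<in>cube n. pw n q y * exp (- z * f y))"
      unfolding exp_add sum_distrib_left by (intro sum.cong) (simp_all add: mult_ac)
    also have "\<dots> \<le> exp (z * (m - \<delta> * real n)) * exp ((\<Sum>y\<in>cube n. pw n q y * (- z * f y)) + real n * (z * Lip n f)\<^sup>2 / 2)"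
    proof (intro mult_left_mono bounded_differences_mgf q)
      fix y i assume "y \<in> cube n" "i < n"
      then have "\<bar>f (y(i := 1)) - f (y(i := - 1))\<bar> \<le> 2 * Lip n f"
        using abs_pd_le_Lip[of i n y f] by (simp add: pd_def)
      then have "z * \<bar>f (y(i := 1)) - f (y(i := - 1))\<bar> \<le> z * (2 * Lip n f)" using z by simp
      moreover have "\<bar>- z * f (y(i := 1)) - - z * f (y(i := - 1))\<bar> = z * \<bar>f (y(i := 1)) - f (y(i := - 1))\<bar>"
      proof -
        have "- z * f (y(i := 1)) - - z * f (y(i := - 1)) = - (z * (f (y(i := 1)) - f (y(i := - 1))))"
          by (simp only: algebra_simps)
        then show ?thesis using z by (simp only: abs_minus_cancel abs_mult abs_of_pos)
      qed
      ultimately show "\<bar>- z * f (y(i := 1)) - - z * f (y(i := - 1))\<bar> \<le> 2 * (z * Lip n f)" by simp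
    qed auto
    also have "(\<Sum>y\<in>cube n. pw n q y * (- z * f y)) = - z * m"
      by (simp add: m_def sum_distrib_left mult_ac sum_negf)
    also have "exp (z * (m - \<delta> * real n)) * exp (- z * m + real n * (z * Lip n f)\<^sup>2 / 2)
        = exp (real n * (z * Lip n f)\<^sup>2 / 2 - z * \<delta> * real n)"
      by (simp add: exp_add[symmetric] algebra_simps)
    also have "\<dots> \<le> exp (- (1 / (2 * \<rho>)))"
    proof -
      have "(Lip n f)\<^sup>2 \<le> \<rho> * (real n * \<delta>\<^sup>2)"
        using that(2) n \<delta> by (simp add: s_def field_simps)
      then have "real n * (z\<^sup>2 * (Lip n f)\<^sup>2) \<le> real n * (z\<^sup>2 * (\<rho> * (real n * \<delta>\<^sup>2)))"
        by (intro mult_left_mono) auto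
      also have "\<dots> = (z * \<rho> * real n * \<delta>)\<^sup>2 / \<rho>" using \<rho> by (simp add: power2_eq_square)
      also have "z * \<rho> * real n * \<delta> = 1" using \<rho> n \<delta> by (simp add: z_def)
      finally have "real n * (z * Lip n f)\<^sup>2 / 2 \<le> 1 / \<rho> / 2" by (simp add: power_mult_distrib)
      moreover have "z * \<delta> * real n = 1 / \<rho>" using \<rho> n \<delta> by (simp add: z_def)
      ultimately show ?thesis by simp
    qed
    \<comment> \<open>With v = 1 / (2 \<rho>) this is exp v >= 2 v, obtained from exp v >= (1 + v /
      2)^2.\<close>
    also have "\<dots> \<le> \<rho>"
    proof -
      define v where "v = 1 / (2 * \<rho>)"
      have v: "0 < v" using \<rho> by (simp add: v_def)
      have "0 \<le> (1 - v / 2)\<^sup>2" by simp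
      then have "2 * v \<le> (1 + v / 2)\<^sup>2" by (simp add: power2_eq_square algebra_simps)
      also have "\<dots> \<le> (exp (v / 2))\<^sup>2" using v exp_ge_add_one_self[of "v / 2"] by (intro power_mono) auto
      also have "\<dots> = exp v" by (simp add: power2_eq_square exp_add[symmetric])
      finally have "exp (- v) \<le> 1 / (2 * v)" using v by (simp add: exp_minus field_simps)
      also have "\<dots> = \<rho>" using \<rho> by (simp add: v_def)
      finally show ?thesis by (simp add: v_def)
    qed
    finally show ?thesis .
  qed
  have Q: "1 - Q \<le> s"
  proof (rule field_le_epsilon)
    fix e :: real assume "0 < e"
    then show "1 - Q \<le> s + e" using s0 by (intro tail) auto
  qed
  then have "A \<noteq> {}" using s by (auto simp: Q_def)
  then show P0: "0 < P" unfolding P_def A_def[symmetric] using w finA by (intro sum_pos) auto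
  have PA: "P = sum (pw n (\<lambda>_. p)) A" by (simp add: P_def A_def)
  have "P \<le> (\<Sum>y\<in>cube n. pw n (\<lambda>_. p) y)"
    unfolding PA using w A by (intro sum_mono2) (auto simp: less_imp_le)
  then have P1: "P \<le> 1" by (simp add: sum_pw)
  \<comment> \<open>This height makes exp T = 1 / P, so the event contributes exactly 1 to the
    exponential sum.\<close>
  define T where "T = - ln P"
  have T: "0 \<le> T" using P0 P1 by (simp add: T_def)
  let ?G = "\<lambda>y. if y \<in> A then T else 0"
  have "(\<Sum>y\<in>cube n. pw n q y * ?G y) \<le> ?KL + ln (\<Sum>y\<in>cube n. pw n (\<lambda>_. p) y * exp (?G y))"
    unfolding KL_def by (rule gibbs_variational) (use wq w in \<open>auto simp: sum_pw\<close>)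
  also have "(\<Sum>y\<in>cube n. pw n q y * ?G y) = T * Q"
  proof -
    have "(\<Sum>y\<in>cube n. pw n q y * ?G y) = (\<Sum>y\<in>A. pw n q y * T)"
      using A by (intro sum.mono_neutral_cong_right) auto
    then show ?thesis by (simp add: Q_def sum_distrib_left mult.commute)
  qed
  also have "(\<Sum>y\<in>cube n. pw n (\<lambda>_. p) y * exp (?G y)) = 2 - P"
  proof -
    have "(\<Sum>y\<in>cube n. pw n (\<lambda>_. p) y * exp (?G y))
        = (\<Sum>y\<in>cube n - A. pw n (\<lambda>_. p) y) + (\<Sum>y\<in>A. pw n (\<lambda>_. p) y / P)"
      unfolding sum.subset_diff[OF A finite_cube, of "\<lambda>y. pw n (\<lambda>_. p) y * exp (?G y)"]
      using P0 by (intro arg_cong2[where f = "(+)"] sum.cong) (auto simp: T_def exp_minus divide_inverse)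
    also have "(\<Sum>y\<in>A. pw n (\<lambda>_. p) y / P) = 1"
      using P0 by (simp add: sum_divide_distrib[symmetric] PA)
    also have "(\<Sum>y\<in>cube n - A. pw n (\<lambda>_. p) y) = 1 - P"
      using sum.subset_diff[OF A, of "pw n (\<lambda>_. p)"] by (simp add: sum_pw PA)
    finally show ?thesis by simp
  qed
  also have "ln (2 - P) \<le> 1" using ln_le_minus_one[of "2 - P"] P0 P1 by simp
  finally have TQ: "T * Q \<le> ?KL + 1" by simp
  have "T * (1 - s) \<le> T * Q" using T Q by (intro mult_left_mono) auto
  then have "T * (1 - s) * (1 + 2 * s) \<le> (?KL + 1) * (1 + 2 * s)"
    using TQ s0 by (intro mult_right_mono) auto
  moreover have "T * 1 \<le> T * ((1 - s) * (1 + 2 * s))"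
  proof (rule mult_left_mono[OF _ T])
    have "0 \<le> s * (1 - 2 * s)" using s s0 by simp
    then show "1 \<le> (1 - s) * (1 + 2 * s)" by (simp add: algebra_simps)
  qed
  ultimately have "T \<le> ?KL * (1 + 2 * s) + (1 + 2 * s)" by (simp add: algebra_simps)
  then show "- ?KL * (1 + 2 * s) - 2 \<le> ln P" using s by (simp add: T_def)
qed

lemma prob_p_eq: "prob_p n p {y. a \<le> f y} = (\<Sum>y | y \<in> cube n \<and> a \<le> f y. pw n (\<lambda>_. p) y)"
  unfolding prob_p_def by (intro sum.cong) (auto simp: mu_p_eq_pw)

theorem theorem1p8:
  fixes n :: nat and f :: "(nat \<Rightarrow> real) \<Rightarrow> real" and p t \<delta> :: real
  assumes "n \<ge> 1" and "0 < p" and "p < 1"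
    and "0 < \<delta>" and "ereal \<delta> < phi n p f (t - \<delta>) / ereal (real n)"
  defines "L \<equiv> (1 / \<delta>) * (2 * Lip n f + \<bar>ln (p * (1 - p))\<bar>) powr (2/3)
                 * (2 * DD n f + (1 / \<delta>) * (Lip n f)\<^sup>2) powr (1/3)"
  shows "(elog (prob_p n p {y. f y \<ge> t * real n})
           \<le> - phi n p f (t - \<delta>) * ereal (1 - 64 * L * real n powr (-1/3)))
         \<and> ((Lip n f)\<^sup>2 / (real n * \<delta>\<^sup>2) \<le> 1/2 \<longrightarrow>
         elog (prob_p n p {y. f y \<ge> (t - \<delta>) * real n})
           \<ge> - phi n p f t * ereal (1 + 2 / (real n * \<delta>\<^sup>2) * (Lip n f)\<^sup>2) - 2)"
proof (intro conjI impI)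
  have w: "0 < pw n (\<lambda>_. p) y" for y using assms(2,3) by (intro pw_pos) auto
  let ?P = "\<lambda>t. \<Sum>y | y \<in> cube n \<and> t * real n \<le> f y. pw n (\<lambda>_. p) y"
  have P0: "0 \<le> ?P t" for t using w by (intro sum_nonneg) (auto simp: less_imp_le)
  show "elog (prob_p n p {y. f y \<ge> t * real n})
      \<le> - phi n p f (t - \<delta>) * ereal (1 - 64 * L * real n powr (-1/3))"
  proof (cases "?P t = 0")
    case True
    then show ?thesis by (simp add: prob_p_eq elog_def)
  next
    case False
    then have pos: "0 < ?P t" using P0[of t] by simp
    then have "{y. y \<in> cube n \<and> t * real n \<le> f y} \<noteq> {}" by (intro notI) simp
    \<comment> \<open>A point mass at such a \<open>y\<close> makes the rate at
      \<open>t - \<delta>\<close> finite.\<close>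
    then obtain y where y: "y \<in> cube n" "t * real n \<le> f y" by blast
    have "(t - \<delta>) * real n \<le> t * real n" using assms(4) by (intro mult_right_mono) auto
    with y have "phi n p f (t - \<delta>) \<le> ereal (- ln (pw n (\<lambda>_. p) y))"
      by (intro phi_le_dirac assms) auto
    then obtain \<Phi> where \<Phi>: "phi n p f (t - \<delta>) = ereal \<Phi>"
      using phi_nonneg[OF assms(2,3), of n f "t - \<delta>"] by (cases "phi n p f (t - \<delta>)") auto
    have "\<delta> < \<Phi> / real n" using assms(1,5) by (simp add: \<Phi>)
    then have "0 < \<Phi> / real n" using assms(4) by linarith
    then have "0 < \<Phi>" using assms(1) by (simp add: zero_less_divide_iff)
    from upper_tail[OF assms(1-4) this \<Phi> pos] show ?thesis
      unfolding L_def[symmetric] using pos by (simp add: prob_p_eq elog_def \<Phi>)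
  qed
next
  assume s: "(Lip n f)\<^sup>2 / (real n * \<delta>\<^sup>2) \<le> 1 / 2"
  define s where "s = (Lip n f)\<^sup>2 / (real n * \<delta>\<^sup>2)"
  have s0: "0 \<le> s" by (simp add: s_def)
  have eq: "1 + 2 / (real n * \<delta>\<^sup>2) * (Lip n f)\<^sup>2 = 1 + 2 * s" by (simp add: s_def)
  let ?P = "\<Sum>y | y \<in> cube n \<and> (t - \<delta>) * real n \<le> f y. pw n (\<lambda>_. p) y"
  show "- phi n p f t * ereal (1 + 2 / (real n * \<delta>\<^sup>2) * (Lip n f)\<^sup>2) - 2
      \<le> elog (prob_p n p {y. f y \<ge> (t - \<delta>) * real n})"
  proof (cases "phi n p f t")
    case PInf
    then show ?thesis unfolding eq using s0 by simp
  next
    case MInf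
    then show ?thesis using phi_nonneg[OF assms(2,3), of n f t] by simp
  next
    case (real \<Phi>)
    have P: "0 < ?P"
    proof (rule ccontr)
      assume "\<not> 0 < ?P"
      \<comment> \<open>An event of probability zero excludes every admissible product measure, so
        the infimum is over the empty set.\<close>
      then have "\<infinity> \<le> phi n p f t"
        using lower_tail(1)[OF assms(1-4) _ _ s] by (intro phi_geI) blast
      then show False using real by simp
    qed
    \<comment> \<open>Solving the bound for the relative entropy gives a lower bound uniform in
      \<open>q\<close>, so it passes to the infimum even if no minimiser is exhibited.\<close>
    have "ereal ((- ln ?P - 2) / (1 + 2 * s)) \<le> phi n p f t"
    proof (rule phi_geI)
      fix q assume "\<And>i. i < n \<Longrightarrow> 0 \<le> q i \<and> q i \<le> 1" "t * real n \<le> (\<Sum>y\<in>cube n. pw n q y * f y)"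
      from lower_tail(2)[OF assms(1-4) this s]
      have "- ln ?P - 2 \<le> KL n (pw n q) (pw n (\<lambda>_. p)) * (1 + 2 * s)" by (simp add: s_def)
      then show "ereal ((- ln ?P - 2) / (1 + 2 * s)) \<le> ereal (KL n (pw n q) (pw n (\<lambda>_. p)))"
        using s0 by (simp add: pos_divide_le_eq)
    qed
    then have "- ln ?P - 2 \<le> \<Phi> * (1 + 2 * s)" using real s0 by (simp add: pos_divide_le_eq)
    then have "ereal (- \<Phi> * (1 + 2 * s) - 2) \<le> ereal (ln ?P)" by simp
    then show ?thesis unfolding eq using P by (simp add: real prob_p_eq elog_def)
  qed
qed

end
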